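(* Let $p\ge1$ be an integer and let $A\subset\mathbb{R}^{p+2}$ be a horizontally convex set with respect to the pair of vector fields $$X=\partial_x,\qquad Y=\partial_y+\sum_{k=1}^p\frac{x^k}{k!}\,\partial_{t_k}$$ on $\mathbb{R}^{p+2}$, with coordinates $(x,y,t_1,\dots,t_p)$. Assume that $(z,t)=(x,y,t_1,\dots,t_p)\in\partial A$ and that there is $Z:=uX+vY$, with $u,v\in\mathbb{R}$, such that $(z,t)\cdot\exp(Z)\in\operatorname{int}(A)$ and $u\ne0$. Then there is $\varepsilon>0$ such that $$\bigcup_{0<s\le1}B\big((z,t)\cdot\exp(sZ),\varepsilon s\big)\subset\operatorname{int}(A).$$
   Context: $\mathbb{R}^{p+2}$ is equipped with the filiform Carnot group (of step $p+1$) law $$(x,y,t)\cdot(\xi,\eta,\tau)=\Big(x+\xi,\;y+\eta,\;t_1+\tau_1+x\eta,\;\dots,\;t_k+\tau_k+\frac{x^k}{k!}\eta+\sum_{j=1}^{k-1}\frac{x^{k-j}}{(k-j)!}\tau_j,\;\dots\Big),\quad k=2,\dots,p,$$ for which $X,Y$ are left-invariant and span the first (horizontal) layer $V_1$ of the Lie algebra. The map $\exp$ is the Lie group exponential: $\exp(Z)$ is the value at time $1$ of the integral curve of $Z$ starting at $0$. A horizontal line is a set $\{\gamma(s):=g\cdot\exp(sW):s\in\mathbb{R}\}$ with $g\in\mathbb{R}^{p+2}$, $W\in V_1=\operatorname{span}\{X,Y\}$. A set $A$ is horizontally convex if, whenever two points $\gamma(a),\gamma(b)$ of a horizontal line belong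 to $A$, the whole horizontal segment $\gamma([a,b])$ is contained in $A$. The subRiemannian distance $d(g,g')$ is the infimum of $\int_a^b|w(\tau)|\,d\tau$ over Lipschitz curves $\gamma:[a,b]\to\mathbb{R}^{p+2}$ connecting $g$ and $g'$ with $\dot\gamma=w_1(\tau)X(\gamma)+w_2(\tau)Y(\gamma)$ a.e., where $w=(w_1,w_2)\in L^1((a,b),\mathbb{R}^2)$. $B(g,r)$ is the ball with center $g$ and radius $r$ with respect to $d$; $\operatorname{int}(A)$ and $\partial A$ are the interior and the boundary of $A$ in the Euclidean topology. *)

theory Defs
  imports "HOL-Analysis.Analysis"
begin

text \<open>
  Points \<open>(x, y, t\<^sub>1, \<dots>, t\<^sub>p)\<close> are triples \<open>(x, y, t)\<close> with \<open>t\<close> a vector indexed by a finite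
  linearly ordered type \<open>'p\<close> with \<open>p\<close> elements. The order supplies the numbering:
  \<open>idx k \<in> {1..p}\<close> is the position of the index \<open>k\<close>.
\<close>

type_synonym 'p point = "real \<times> real \<times> (real ^ 'p)"

definition idx :: "'p::{finite,linorder} \<Rightarrow> nat" where
  "idx k = card {..k}"

lemma strict_mono_idx: "strict_mono (idx :: 'p::{finite,linorder} \<Rightarrow> nat)"
  unfolding idx_def by (intro strict_monoI psubset_card_mono) auto

lemma bij_betw_idx: "bij_betw (idx :: 'p::{finite,linorder} \<Rightarrow> nat) UNIV {1..CARD('p)}"
proof -
  have inj: "inj (idx :: 'p \<Rightarrow> nat)"
    by (rule strict_mono_imp_inj_on[OF strict_mono_idx])
  have "idx k \<in> {1..CARD('p)}" for k :: 'p
    using card_mono[of "{..k}" "{k}"] card_mono[of UNIV "{..k}"] by (simp add: idx_def)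
  then have "range (idx :: 'p \<Rightarrow> nat) \<subseteq> {1..CARD('p)}" by blast
  moreover have "card (range (idx :: 'p \<Rightarrow> nat)) = card {1..CARD('p)}"
    using inj by (simp add: card_image)
  ultimately have "range (idx :: 'p \<Rightarrow> nat) = {1..CARD('p)}"
    by (intro card_subset_eq) auto
  with inj show ?thesis by (simp add: bij_betw_def)
qed

text \<open>
  The group law. In the first \<open>t\<close>-coordinate the sum is empty, leaving \<open>t\<^sub>1 + \<tau>\<^sub>1 + x \<eta>\<close>.
\<close>

fun fil_mult :: "'p::{finite,linorder} point \<Rightarrow> 'p point \<Rightarrow> 'p point"  (infixl "\<odot>" 70) where
  "(x, y, t) \<odot> (\<xi>, \<eta>, \<tau>) =
     (x + \<xi>, y + \<eta>,
      \<chi> k. t $ k + \<tau> $ k + x ^ idx k / fact (idx k) * \<eta>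
          + (\<Sum>j\<in>{..<k}. x ^ (idx k - idx j) / fact (idx k - idx j) * \<tau> $ j))"

text \<open>A vector field is represented by its coefficient function in the coordinate frame.\<close>

fun X_field :: "'p::{finite,linorder} point \<Rightarrow> 'p point" where
  "X_field (x, y, t) = (1, 0, 0)"

fun Y_field :: "'p::{finite,linorder} point \<Rightarrow> 'p point" where
  "Y_field (x, y, t) = (0, 1, \<chi> k. x ^ idx k / fact (idx k))"

definition V1 :: "('p::{finite,linorder} point \<Rightarrow> 'p point) set" where
  "V1 = {W. \<exists>u v. W = (\<lambda>g. u *\<^sub>R X_field g + v *\<^sub>R Y_field g)}"

definition integral_curve ::
    "('p::{finite,linorder} point \<Rightarrow> 'p point) \<Rightarrow> (real \<Rightarrow> 'p point) \<Rightarrow> bool" where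
  "integral_curve Z \<gamma> \<longleftrightarrow> (\<forall>s. (\<gamma> has_vector_derivative Z (\<gamma> s)) (at s))"

definition lie_exp :: "('p::{finite,linorder} point \<Rightarrow> 'p point) \<Rightarrow> 'p point" where
  "lie_exp Z = (THE h. \<exists>\<gamma>. integral_curve Z \<gamma> \<and> \<gamma> 0 = 0 \<and> \<gamma> 1 = h)"

definition horizontal_line ::
    "'p::{finite,linorder} point \<Rightarrow> ('p point \<Rightarrow> 'p point) \<Rightarrow> real \<Rightarrow> 'p point" where
  "horizontal_line g W s = g \<odot> lie_exp (\<lambda>h. s *\<^sub>R W h)"

definition horizontally_convex :: "'p::{finite,linorder} point set \<Rightarrow> bool" where
  "horizontally_convex A \<longleftrightarrow>
     (\<forall>g. \<forall>W\<in>V1. \<forall>a b. a \<le> b \<longrightarrow> horizontal_line g W a \<in> A \<longrightarrow> horizontal_line g W b \<in> A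
        \<longrightarrow> horizontal_line g W ` {a..b} \<subseteq> A)"

definition horizontal_curve ::
    "real \<Rightarrow> real \<Rightarrow> (real \<Rightarrow> 'p::{finite,linorder} point) \<Rightarrow> (real \<Rightarrow> real \<times> real) \<Rightarrow> bool" where
  "horizontal_curve a b \<gamma> w \<longleftrightarrow>
     (\<exists>L. L-lipschitz_on {a..b} \<gamma>) \<and>
     w absolutely_integrable_on {a<..<b} \<and>
     (AE \<tau> in lebesgue. \<tau> \<in> {a<..<b} \<longrightarrow>
        (\<gamma> has_vector_derivative
           (fst (w \<tau>) *\<^sub>R X_field (\<gamma> \<tau>) + snd (w \<tau>) *\<^sub>R Y_field (\<gamma> \<tau>))) (at \<tau>))"

text \<open>
  The norm on \<^typ>\<open>real \<times> real\<close> is the Euclidean one. The infimum is taken over a set of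
  nonnegative reals which is nonempty, since any two points are joined by a horizontal curve.
\<close>

definition sr_dist :: "'p::{finite,linorder} point \<Rightarrow> 'p point \<Rightarrow> real" where
  "sr_dist g g' =
     Inf {integral {a<..<b} (\<lambda>\<tau>. norm (w \<tau>)) | a b \<gamma> w.
            a < b \<and> horizontal_curve a b \<gamma> w \<and> \<gamma> a = g \<and> \<gamma> b = g'}"

definition sr_ball :: "'p::{finite,linorder} point \<Rightarrow> real \<Rightarrow> 'p point set" where
  "sr_ball g r = {h. sr_dist g h < r}"

end

theory Submission
  imports Defs
begin

text \<open>
  Write a point as \<open>(x, T)\<close> with \<open>T = (y, t)\<close> in the fibre \<open>\<real> \<times> \<real>\<^sup>p\<close>, and let \<open>m(\<xi>)\<close> be the curve of
  divided powers \<open>(1, \<xi>, \<xi>\<^sup>2/2!, \<dots>, \<xi>\<^sup>p/p!)\<close>, with primitive \<open>M\<close> vanishing at 0. The horizontal line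
  through \<open>(x\<^sub>0, T\<^sub>0)\<close> in direction \<open>uX + vY\<close>, \<open>u \<noteq> 0\<close>, is the graph
  \<open>x \<mapsto> T\<^sub>0 + c (M(x) - M(x\<^sub>0))\<close> with slope \<open>c = v/u\<close>. Let \<open>c\<^sub>0\<close> be the slope of the given line, which
  leads from the base point \<open>(x\<^sub>0, T\<^sub>0)\<close> in the closure of \<open>A\<close> into the interior of \<open>A\<close>. By openness it
  is still in the interior at some abscissa \<open>x\<^sub>1\<close> slightly beyond its endpoint.

  Start at a point \<open>q\<close> of \<open>A\<close> near the base point and follow finitely many horizontal lines whose slopes
  differ from \<open>c\<^sub>0\<close> by at most a small \<open>\<delta>\<close>. At every vertex, the next line, prolonged to abscissa
  \<open>x\<^sub>1\<close>, ends near the given interior point, hence in \<open>A\<close>; horizontal convexity then puts the next vertex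
  into \<open>A\<close>. Thus \<open>A\<close> contains everything that \<open>q\<close> reaches with such slopes (lemma \<open>reachable_in_set\<close>).

  This reachable set is large. A nonzero linear form on the fibre, evaluated along \<open>m\<close>, is a nonzero
  polynomial of degree at most \<open>p\<close>; hence the increments of \<open>M\<close> over \<open>p + 1\<close> equal subintervals of
  \<open>[0, 1]\<close> span the fibre, and \<open>p + 1\<close> slopes suffice to steer to any target (lemma \<open>steering\<close>). Left
  translations and dilations reduce every interval to \<open>[0, 1]\<close>, so the size of the slopes is controlled by
  one normalised displacement, \<open>rel_moment\<close>. As this is continuous in \<open>q\<close>, one may let \<open>q\<close> tend to the
  base point, which need not belong to \<open>A\<close>: all points with small normalised displacement from the base
  point lie in \<open>A\<close>, and they form an open set (lemma \<open>cone_region\<close>).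

  The balls of the theorem lie in that open set. A horizontal curve of length less than \<open>\<epsilon> s\<close> starting on the
  line at parameter \<open>s\<close> changes, after translation and dilation by \<open>1/s\<close>, every coordinate by
  \<open>O(\<epsilon>)\<close> uniformly in \<open>s\<close> (lemma \<open>sr_ball_rel_moment\<close>). This uses the fundamental theorem of calculus for
  Lipschitz curves differentiable almost everywhere, and the fact that any two points are joined by a
  horizontal curve, without which the infimum defining the distance would carry no information.
\<close>

section \<open>Divided powers, left translations and dilations\<close>

type_synonym 'p fibre = "real \<times> (real ^ 'p)"

text \<open>
  The divided powers \<open>(1, \<xi>, \<xi>\<^sup>2/2!, \<dots>)\<close> form the fibre part of \<open>Y\<close> at abscissa \<open>\<xi>\<close>; normalising by
  factorials turns the binomial theorem into the group law.
\<close>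

definition moment :: "real \<Rightarrow> 'p::{finite,linorder} fibre" where
  "moment \<xi> = (1, \<chi> k. \<xi> ^ idx k / fact (idx k))"

definition moment_prim :: "real \<Rightarrow> 'p::{finite,linorder} fibre" where
  "moment_prim \<xi> = (\<xi>, \<chi> k. \<xi> ^ Suc (idx k) / fact (Suc (idx k)))"

text \<open>
  The unipotent matrix by which left translation by a point of abscissa \<open>x\<close> acts on the fibre: the product is
  \<open>(x, T) \<odot> (\<xi>, S) = (x + \<xi>, T + shift x S)\<close>.
\<close>

definition shift :: "real \<Rightarrow> 'p::{finite,linorder} fibre \<Rightarrow> 'p::{finite,linorder} fibre" where
  "shift x S = (fst S, \<chi> k. snd S $ k + x ^ idx k / fact (idx k) * fst S
     + (\<Sum>j\<in>{..<k}. x ^ (idx k - idx j) / fact (idx k - idx j) * snd S $ j))"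

text \<open>
  The fibre part of the intrinsic dilation of the Carnot group, in which \<open>y\<close> has weight 1 and \<open>t\<^sub>k\<close> has weight
  \<open>k + 1\<close>.
\<close>

definition dil :: "real \<Rightarrow> 'p::{finite,linorder} fibre \<Rightarrow> 'p::{finite,linorder} fibre" where
  "dil r S = (r * fst S, \<chi> k. r ^ Suc (idx k) * snd S $ k)"

lemma idx_pos: "0 < idx (k::'p::{finite,linorder})"
  using bij_betw_idx[where 'p='p] by (auto simp: bij_betw_def set_eq_iff image_iff Bex_def) (metis One_nat_def less_eq_Suc_le)

lemma idx_less_iff: "idx j < idx k \<longleftrightarrow> j < (k::'p::{finite,linorder})"
  by (rule strict_mono_less[OF strict_mono_idx])

lemma inj_idx: "inj (idx :: 'p::{finite,linorder} \<Rightarrow> nat)"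
  using bij_betw_idx bij_betw_def by blast

lemma idx_image_lessThan: "idx ` {..<k} = {1..<idx (k::'p::{finite,linorder})}"
proof (rule card_subset_eq)
  show "idx ` {..<k} \<subseteq> {1..<idx k}"
    using idx_pos by (auto simp: idx_less_iff Suc_le_eq)
  have "{..k} = insert k {..<k}" by auto
  then have "card {..<k} = idx k - 1" unfolding idx_def by simp
  then show "card (idx ` {..<k}) = card {1..<idx k}"
    by (subst card_image) (auto intro: inj_on_subset[OF inj_idx])
qed auto

lemma mult_eq: "(x, T) \<odot> (\<xi>, S) = (x + \<xi>, T + shift x S)"
  by (cases T; cases S) (simp add: shift_def vec_eq_iff algebra_simps)

lemma linear_shift: "linear (shift x)"
  by (rule linearI)
     (auto simp: shift_def vec_eq_iff algebra_simps add_divide_distrib sum.distrib sum_distrib_left)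

lemma linear_dil: "linear (dil r)"
  by (rule linearI) (auto simp: dil_def vec_eq_iff algebra_simps)

lemma binomial_divided_power:
  fixes x \<xi> :: real
  assumes "0 < n"
  shows "(x + \<xi>) ^ n / fact n = \<xi> ^ n / fact n + x ^ n / fact n
     + (\<Sum>m\<in>{1..<n}. x ^ (n - m) / fact (n - m) * (\<xi> ^ m / fact m))"
proof -
  have "(x + \<xi>) ^ n / fact n = (\<Sum>m\<le>n. x ^ (n - m) / fact (n - m) * (\<xi> ^ m / fact m))"
    unfolding binomial_ring[of \<xi> x n, simplified add.commute[of \<xi> x]] sum_divide_distrib
    by (intro sum.cong refl) (simp add: binomial_fact field_simps)
  also have "{..n} = insert n (insert 0 {1..<n})" using assms by auto
  finally show ?thesis using assms by simp
qed

text \<open>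
  Left invariance of \<open>Y\<close>. Coordinatewise this is the binomial theorem; the sum in the group law runs over the
  interior binomial terms and the two extreme terms stand apart.
\<close>

lemma shift_moment: "shift x (moment \<xi>) = (moment (x + \<xi>) :: 'p::{finite,linorder} fibre)"
proof -
  have "(\<Sum>j\<in>{..<k}. x ^ (idx k - idx j) / fact (idx k - idx j) * (\<xi> ^ idx j / fact (idx j))) =
     (\<Sum>m\<in>{1..<idx k}. x ^ (idx k - m) / fact (idx k - m) * (\<xi> ^ m / fact m))" for k :: "'p::{finite,linorder}"
    unfolding idx_image_lessThan[symmetric]
    by (subst sum.reindex) (auto intro: inj_on_subset[OF inj_idx])
  then show ?thesis
    by (auto simp: shift_def moment_def vec_eq_iff binomial_divided_power[OF idx_pos, of x \<xi>])
qed

lemma has_vector_derivative_vec_lambda: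
  assumes "\<And>i. ((\<lambda>x. f x i) has_real_derivative f' i) (at x within S)"
  shows "((\<lambda>x. \<chi> i. f x i) has_vector_derivative (\<chi> i. f' i)) (at x within S)"
  using assms unfolding has_vector_derivative_def has_field_derivative_def
  by (subst has_derivative_componentwise_within)
     (auto simp: Basis_vec_def inner_axis mult_commute_abs)

lemma moment_prim_deriv:
  "((moment_prim :: real \<Rightarrow> 'p::{finite,linorder} fibre) has_vector_derivative moment \<xi>) (at \<xi> within S)"
proof -
  have "((\<lambda>\<xi>. \<xi> ^ Suc (idx k) / fact (Suc (idx k))) has_real_derivative \<xi> ^ idx k / fact (idx k)) (at \<xi> within S)" for k :: "'p::{finite,linorder}"
    by (rule derivative_eq_intros refl | simp)+ 
  then show ?thesis
    unfolding moment_prim_def moment_def 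
    by (intro has_vector_derivative_Pair has_vector_derivative_vec_lambda) auto
qed

lemma moment_prim_0 [simp]: "moment_prim 0 = 0"
  by (simp add: moment_prim_def vec_eq_iff prod_eq_iff)

text \<open>
  The integrated form of \<open>shift_moment\<close>: both sides have the same derivative in \<open>\<xi>\<close> and agree at 0.
\<close>

lemma shift_moment_prim:
  "shift x (moment_prim \<xi>) = (moment_prim (x + \<xi>) - moment_prim x :: 'p::{finite,linorder} fibre)"
proof -
  let ?F = "\<lambda>\<xi>. shift x (moment_prim \<xi>) - (moment_prim (x + \<xi>) :: 'p::{finite,linorder} fibre)"
  have "(?F has_vector_derivative 0) (at \<xi>)" for \<xi>
  proof -
    have "((\<lambda>\<xi>. moment_prim (x + \<xi>) :: 'p::{finite,linorder} fibre) has_vector_derivative moment (x + \<xi>)) (at \<xi>)"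
      using vector_diff_chain_at[OF _ moment_prim_deriv, of "\<lambda>\<xi>. x + \<xi>" 1 \<xi>]
      by (simp add: o_def has_vector_derivative_add_const add.commute[of x])
    then have "(?F has_vector_derivative shift x (moment \<xi>) - moment (x + \<xi>)) (at \<xi>)"
      using bounded_linear.has_vector_derivative[OF linear_shift[THEN linear_conv_bounded_linear[THEN iffD1]] moment_prim_deriv]
      by (intro has_vector_derivative_diff)
    then show ?thesis by (simp add: shift_moment)
  qed
  then obtain c where c: "\<And>\<xi>. \<xi> \<in> UNIV \<Longrightarrow> ?F \<xi> = c"
    by (rule has_vector_derivative_zero_constant[OF convex_UNIV]) blast
  have "?F \<xi> = ?F 0" using c[of 0] c[of \<xi>] by simp
  also have "?F 0 = - moment_prim x"
    using linear_0[OF linear_shift, of x] by simp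
  finally show ?thesis by (simp only: diff_eq_eq) simp
qed

lemma dil_moment_prim: "dil r (moment_prim \<xi>) = moment_prim (r * \<xi>)"
  by (simp add: dil_def moment_prim_def vec_eq_iff power_mult_distrib)

lemma dil_moment: "dil r (moment \<xi>) = r *\<^sub>R moment (r * \<xi>)"
  by (simp add: dil_def moment_def vec_eq_iff power_mult_distrib)

lemma dil_dil: "dil r (dil s S) = dil (r * s) S"
  by (simp add: dil_def vec_eq_iff power_mult_distrib)

lemma dil_1 [simp]: "dil 1 S = S"
  by (simp add: dil_def)

section \<open>Increments of the moment curve span the fibre\<close>

text \<open>
  The coefficients of the polynomial \<open>\<xi> \<mapsto> a \<bullet> moment \<xi>\<close>. Degree 0 belongs to the coordinate \<open>y\<close>, degree
  \<open>m \<ge> 1\<close> to the coordinate whose index has position \<open>m\<close>.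
\<close>

definition moment_poly :: "'p::{finite,linorder} fibre \<Rightarrow> nat \<Rightarrow> real" where
  "moment_poly a m = (if m = 0 then fst a else snd a $ inv idx m) / fact m"

lemma sum_idx: "(\<Sum>k\<in>UNIV. f (idx (k::'p::{finite,linorder}))) = (\<Sum>m\<in>{1..CARD('p)}. f m)"
  by (rule sum.reindex_bij_betw[OF bij_betw_idx])

lemma inner_moment:
  fixes a :: "'p::{finite,linorder} fibre"
  shows "a \<bullet> moment \<xi> = (\<Sum>m\<le>CARD('p). moment_poly a m * \<xi> ^ m)"
proof -
  have "{..CARD('p)} = insert 0 {1..CARD('p)}" by auto
  then have "(\<Sum>m\<le>CARD('p). moment_poly a m * \<xi> ^ m) = fst a + (\<Sum>k\<in>UNIV. moment_poly a (idx (k::'p)) * \<xi> ^ idx k)"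
    unfolding sum_idx[of "\<lambda>m. moment_poly a m * \<xi> ^ m", where 'p='p] by (simp add: moment_poly_def)
  also have "(\<Sum>k\<in>UNIV. moment_poly a (idx (k::'p)) * \<xi> ^ idx k) = (\<Sum>k\<in>UNIV. snd a $ k * (\<xi> ^ idx k / fact (idx k)))"
    by (intro sum.cong refl) (simp add: idx_pos idx_pos[THEN gr_implies_not0] moment_poly_def inv_f_f[OF inj_idx])
  finally show ?thesis
    by (cases a) (simp add: moment_def inner_vec_def)
qed

lemma moment_poly_nonzero:
  fixes a :: "'p::{finite,linorder} fibre"
  assumes "a \<noteq> 0"
  shows "\<exists>m\<le>CARD('p). moment_poly a m \<noteq> 0"
proof (rule ccontr)
  assume *: "\<not> ?thesis"
  have "fst a = 0" using * by (auto simp: moment_poly_def dest: spec[of _ 0])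
  moreover have "snd a $ k = 0" for k
  proof -
    have "idx k \<le> CARD('p)" unfolding idx_def by (intro card_mono) auto
    with * have "moment_poly a (idx k) = 0" by blast
    then show ?thesis using idx_pos[of k] by (simp add: moment_poly_def inv_f_f[OF inj_idx])
  qed
  ultimately show False using assms by (simp add: prod_eq_iff vec_eq_iff)
qed

lemma finite_moment_zeros:
  fixes a :: "'p::{finite,linorder} fibre"
  assumes "a \<noteq> 0"
  shows "finite {\<xi>. a \<bullet> moment \<xi> = 0}"
  unfolding inner_moment polyfun_finite_roots using moment_poly_nonzero[OF assms] .

definition node :: "nat \<Rightarrow> nat \<Rightarrow> real" where
  "node n i = real i / real (Suc n)"

text \<open>
  If a linear form \<open>a\<close> kills all \<open>p + 1\<close> increments, then \<open>a \<bullet> moment_prim\<close> takes equal values at consecutive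
  nodes, so by the mean value theorem its derivative \<open>a \<bullet> moment\<close> has a zero strictly inside each of the \<open>p + 1\<close> subintervals.
  That is one zero too many for a nonzero polynomial of degree at most \<open>p\<close>.
\<close>

lemma moment_spanning:
  "span ((\<lambda>i. moment_prim (node CARD('p) (Suc i)) - moment_prim (node CARD('p) i)) ` {..CARD('p)})
    = (UNIV :: ('p::{finite,linorder} fibre) set)"
proof (rule ccontr)
  define n where "n = Suc CARD('p)"
  let ?\<Phi> = "moment_prim :: real \<Rightarrow> 'p::{finite,linorder} fibre"
  let ?W = "(\<lambda>i. ?\<Phi> (real (Suc i) / n) - ?\<Phi> (real i / n)) ` {..CARD('p)}"
  assume "\<not> ?thesis"
  then have "span ?W \<noteq> UNIV" by (simp only: n_def node_def not_False_eq_True)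
  then obtain a where a: "a \<noteq> 0" and sub: "span ?W \<subseteq> {x. a \<bullet> x = 0}"
    using span_not_univ_subset_hyperplane by blast
  have orth: "a \<bullet> (?\<Phi> (real (Suc i) / n) - ?\<Phi> (real i / n)) = 0" if "i < n" for i
  proof -
    have "?\<Phi> (real (Suc i) / n) - ?\<Phi> (real i / n) \<in> span ?W"
      using that by (intro span_base imageI) (simp add: n_def)
    with sub show ?thesis by blast
  qed
  have "\<exists>\<xi>. real i / n < \<xi> \<and> \<xi> < real (Suc i) / n \<and> a \<bullet> moment \<xi> = 0" if "i < n" for i
  proof -
    have lt: "real i / n < real (Suc i) / n" by (simp add: n_def divide_strict_right_mono)
    have D: "((\<lambda>\<xi>. a \<bullet> ?\<Phi> \<xi>) has_real_derivative a \<bullet> moment \<xi>) (at \<xi>)" for \<xi>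
      unfolding has_real_derivative_iff_has_vector_derivative
      by (rule bounded_linear.has_vector_derivative[OF bounded_linear_inner_right moment_prim_deriv])
    obtain z where "real i / n < z" "z < real (Suc i) / n"
      "a \<bullet> ?\<Phi> (real (Suc i) / n) - a \<bullet> ?\<Phi> (real i / n) = (real (Suc i) / n - real i / n) * (a \<bullet> moment z)"
      using MVT2[OF lt D] by blast
    moreover from this have "a \<bullet> moment z = 0"
      using orth[OF that] lt that unfolding inner_diff_right by auto
    ultimately show ?thesis by blast
  qed
  then obtain \<xi> where \<xi>: "\<And>i. i < n \<Longrightarrow> real i / n < \<xi> i" "\<And>i. i < n \<Longrightarrow> \<xi> i < real (Suc i) / n"
    "\<And>i. i < n \<Longrightarrow> a \<bullet> moment (\<xi> i) = 0" by metis
  have "inj_on \<xi> {..<n}"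
  proof (rule linorder_inj_onI)
    fix i j assume "i < j" "i \<in> {..<n}" "j \<in> {..<n}"
    then have "\<xi> i < real (Suc i) / n" "real j / n < \<xi> j" using \<xi> by auto
    moreover have "real (Suc i) / n \<le> real j / n" using \<open>i < j\<close> by (intro divide_right_mono) auto
    ultimately show "\<xi> i \<noteq> \<xi> j" by linarith
  qed auto
  then have "n = card (\<xi> ` {..<n})" by (simp add: card_image)
  also have "\<dots> \<le> card {\<xi>. a \<bullet> moment \<xi> = 0}"
    using \<xi>(3) by (intro card_mono finite_moment_zeros a) auto
  also have "\<dots> \<le> CARD('p)"
    using moment_poly_nonzero[OF a] polyfun_roots_card unfolding inner_moment by blast
  finally show False by (simp add: n_def)
qed

section \<open>Horizontal lines as graphs over the abscissa\<close>

lemma X_field_eq: "X_field (x, T) = (1, 0)"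
  by (cases T) (simp add: zero_prod_def)

lemma Y_field_eq: "Y_field (x, T) = (0, moment x)"
  by (cases T) (simp add: moment_def)

text \<open>
  The equation is triangular: the abscissa is determined first, and the velocity of the fibre part depends on
  the abscissa only. So two solutions have a difference with zero derivative.
\<close>

lemma integral_curve_unique:
  fixes \<gamma> \<delta> :: "real \<Rightarrow> 'p::{finite,linorder} point"
  assumes "integral_curve (\<lambda>g. a *\<^sub>R X_field g + b *\<^sub>R Y_field g) \<gamma>" "\<gamma> 0 = (0, 0)"
    and "integral_curve (\<lambda>g. a *\<^sub>R X_field g + b *\<^sub>R Y_field g) \<delta>" "\<delta> 0 = (0, 0)"
  shows "\<gamma> = \<delta>"
proof
  fix s
  have deriv: "(\<zeta> has_vector_derivative (a, b *\<^sub>R moment (fst (\<zeta> s)))) (at s)"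
    if "integral_curve (\<lambda>g. a *\<^sub>R X_field g + b *\<^sub>R Y_field g) \<zeta>" for \<zeta> :: "real \<Rightarrow> 'p point" and s
  proof -
    have "a *\<^sub>R X_field g + b *\<^sub>R Y_field g = (a, b *\<^sub>R moment (fst g))" for g :: "'p point"
      by (cases g) (simp only: X_field_eq Y_field_eq fst_conv scaleR_Pair add_Pair scaleR_zero_right, simp)
    then show ?thesis using that unfolding integral_curve_def by simp
  qed
  have const: "\<zeta> s = \<zeta> 0" if z: "\<And>s. (\<zeta> has_vector_derivative 0) (at s)" for \<zeta> :: "real \<Rightarrow> 'p point" and s
  proof -
    obtain k where "\<And>s. s \<in> UNIV \<Longrightarrow> \<zeta> s = k"
      by (rule has_vector_derivative_zero_constant[OF convex_UNIV z]) blast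
    from this[of s] this[of 0] show ?thesis by simp
  qed
  have fst: "fst (\<zeta> s) = a * s"
    if "integral_curve (\<lambda>g. a *\<^sub>R X_field g + b *\<^sub>R Y_field g) \<zeta>" "\<zeta> 0 = (0, 0)" for \<zeta> :: "real \<Rightarrow> 'p point" and s
  proof -
    have "((\<lambda>s. fst (\<zeta> s) - a * s) has_vector_derivative 0) (at s)" for s
      using bounded_linear.has_vector_derivative[OF bounded_linear_fst deriv[OF that(1), of s]]
      by (auto intro!: derivative_eq_intros)
    then obtain k where "\<And>s. s \<in> UNIV \<Longrightarrow> fst (\<zeta> s) - a * s = k"
      by (rule has_vector_derivative_zero_constant[OF convex_UNIV]) blast
    from this[of s] this[of 0] show ?thesis using that(2) by simp
  qed
  have "((\<lambda>s. \<gamma> s - \<delta> s) has_vector_derivative 0) (at s)" for s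
    using has_vector_derivative_diff[OF deriv[OF assms(1), of s] deriv[OF assms(3), of s]]
      fst[OF assms(1,2)] fst[OF assms(3,4)] by (simp add: zero_prod_def)
  from const[OF this, of s] assms show "\<gamma> s = \<delta> s" by simp
qed

text \<open>
  For \<open>u \<noteq> 0\<close> the fibre velocity \<open>v\<close> times \<open>moment\<close> is integrated by substituting the abscissa for the time.
\<close>

lemma lie_exp_eq:
  assumes "u \<noteq> 0"
  shows "lie_exp (\<lambda>g. s *\<^sub>R (u *\<^sub>R X_field g + v *\<^sub>R Y_field g))
    = (s * u, (v / u) *\<^sub>R moment_prim (s * u) :: 'p::{finite,linorder} fibre)"
proof -
  define \<gamma> where "\<gamma> \<tau> = (\<tau> * (s * u), (v / u) *\<^sub>R moment_prim (\<tau> * (s * u)) :: 'p fibre)" for \<tau>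
  let ?Z = "\<lambda>g :: 'p point. (s * u) *\<^sub>R X_field g + (s * v) *\<^sub>R Y_field g"
  have "((\<lambda>\<tau>. moment_prim (\<tau> * (s * u)) :: 'p fibre) has_vector_derivative
       (s * u) *\<^sub>R moment (\<tau> * (s * u))) (at \<tau>)" for \<tau>
    using vector_diff_chain_at[OF _ moment_prim_deriv, of "\<lambda>\<tau>. \<tau> * (s * u)" "s * u" \<tau>]
      has_vector_derivative_mult_left[OF has_vector_derivative_id, of "s * u"] by (simp add: o_def)
  then have "(\<gamma> has_vector_derivative (s * u, (v / u) *\<^sub>R (s * u) *\<^sub>R moment (\<tau> * (s * u)))) (at \<tau>)" for \<tau>
    unfolding \<gamma>_def
    by (intro has_vector_derivative_Pair bounded_linear.has_vector_derivative[OF bounded_linear_scaleR_right])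
       (auto intro!: derivative_eq_intros)
  then have int: "integral_curve ?Z \<gamma>"
    unfolding integral_curve_def using assms by (simp add: \<gamma>_def X_field_eq Y_field_eq mult.commute[of s v])
  have 0: "\<gamma> 0 = (0, 0)" by (simp add: \<gamma>_def)
  have "lie_exp ?Z = \<gamma> 1"
    unfolding lie_exp_def
    by (rule the_equality) (use int 0 in \<open>auto simp: zero_prod_def dest: integral_curve_unique\<close>)
  then show ?thesis by (simp add: \<gamma>_def scaleR_add_right)
qed

lemma mult_lie_exp:
  assumes "u \<noteq> 0"
  shows "(x, T) \<odot> lie_exp (\<lambda>g. s *\<^sub>R (u *\<^sub>R X_field g + v *\<^sub>R Y_field g))
    = (x + s * u, T + (v / u) *\<^sub>R (moment_prim (x + s * u) - moment_prim x :: 'p::{finite,linorder} fibre))"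
  unfolding lie_exp_eq[OF assms] mult_eq linear_cmul[OF linear_shift] shift_moment_prim ..

text \<open>
  Lines are parametrised by their abscissa, so that only the slope \<open>c\<close> matters; the endpoints may come in
  either order.
\<close>

lemma horizontally_convexD:
  fixes T :: "'p::{finite,linorder} fibre"
  assumes A: "horizontally_convex A" and P: "(x\<^sub>0, T) \<in> A"
    and Q: "(x\<^sub>1, T + c *\<^sub>R (moment_prim x\<^sub>1 - moment_prim x\<^sub>0)) \<in> A"
    and x: "x \<in> closed_segment x\<^sub>0 x\<^sub>1"
  shows "(x, T + c *\<^sub>R (moment_prim x - moment_prim x\<^sub>0)) \<in> A"
proof -
  define W where "W = (\<lambda>g :: 'p point. 1 *\<^sub>R X_field g + c *\<^sub>R Y_field g)"
  have W: "W \<in> V1" unfolding V1_def W_def by blast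
  have line: "horizontal_line (x\<^sub>0, T) W s = (x\<^sub>0 + s, T + c *\<^sub>R (moment_prim (x\<^sub>0 + s) - moment_prim x\<^sub>0))" for s
    unfolding horizontal_line_def W_def using mult_lie_exp[of 1 x\<^sub>0 T s c] by simp
  note convex = A[unfolded horizontally_convex_def, rule_format, OF W, of _ _ "(x\<^sub>0, T)"]
  have "horizontal_line (x\<^sub>0, T) W (x - x\<^sub>0) \<in> A"
  proof (cases "x\<^sub>0 \<le> x\<^sub>1")
    case True
    have "horizontal_line (x\<^sub>0, T) W ` {0..x\<^sub>1 - x\<^sub>0} \<subseteq> A"
      by (rule convex) (use True P Q in \<open>simp_all add: line\<close>)
    then show ?thesis
      by (rule subsetD) (use x True in \<open>simp add: closed_segment_eq_real_ivl\<close>)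
  next
    case False
    have "horizontal_line (x\<^sub>0, T) W ` {x\<^sub>1 - x\<^sub>0..0} \<subseteq> A"
      by (rule convex) (use False P Q in \<open>simp_all add: line\<close>)
    then show ?thesis
      by (rule subsetD) (use x False in \<open>simp add: closed_segment_eq_real_ivl\<close>)
  qed
  then show ?thesis by (simp add: line)
qed

section \<open>Steering along polygonal horizontal paths\<close>

text \<open>
  Each vertex is reached because the line leaving its predecessor, if prolonged to abscissa \<open>x\<^sub>1\<close>, would end
  in \<open>A\<close>; the new vertex lies between two points of \<open>A\<close> on that line. The prolongation serves as an anchor only,
  the path itself turns off before reaching it.
\<close>

lemma polygonal_path:
  fixes T :: "'p::{finite,linorder} fibre" and \<xi> :: "nat \<Rightarrow> real" and c :: "nat \<Rightarrow> real" and c\<^sub>0 :: real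
  defines "P \<equiv> \<lambda>i. T + c\<^sub>0 *\<^sub>R (moment_prim (\<xi> i) - moment_prim (\<xi> 0))
     + (\<Sum>j<i. c j *\<^sub>R (moment_prim (\<xi> (Suc j)) - moment_prim (\<xi> j)))"
  assumes A: "horizontally_convex A" and start: "(\<xi> 0, T) \<in> A"
    and between: "\<And>i. i < n \<Longrightarrow> \<xi> (Suc i) \<in> closed_segment (\<xi> i) x\<^sub>1"
    and aim: "\<And>i. i < n \<Longrightarrow> (x\<^sub>1, P i + (c\<^sub>0 + c i) *\<^sub>R (moment_prim x\<^sub>1 - moment_prim (\<xi> i))) \<in> A"
    and "i \<le> n"
  shows "(\<xi> i, P i) \<in> A"
  using \<open>i \<le> n\<close>
proof (induction i)
  case 0
  then show ?case using start by (simp add: P_def)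
next
  case (Suc i)
  then have "(\<xi> (Suc i), P i + (c\<^sub>0 + c i) *\<^sub>R (moment_prim (\<xi> (Suc i)) - moment_prim (\<xi> i))) \<in> A"
    by (intro horizontally_convexD[OF A _ aim between]) auto
  also have "P i + (c\<^sub>0 + c i) *\<^sub>R (moment_prim (\<xi> (Suc i)) - moment_prim (\<xi> i)) = P (Suc i)"
    by (simp add: P_def algebra_simps)
  finally show ?case .
qed

lemma span_image_sum:
  assumes "finite I" "x \<in> span (w ` I)"
  shows "\<exists>r. x = (\<Sum>i\<in>I. r i *\<^sub>R w i)"
  using assms(2)
proof (induction rule: span_induct_alt)
  case base
  show ?case by (rule exI[of _ "\<lambda>_. 0"]) simp
next
  case (step c y z)
  then obtain j r where "j \<in> I" "y = w j" "z = (\<Sum>i\<in>I. r i *\<^sub>R w i)" by auto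
  moreover have "(\<Sum>i\<in>I. (r i + (if i = j then c else 0)) *\<^sub>R w i) = (\<Sum>i\<in>I. r i *\<^sub>R w i) + c *\<^sub>R w j"
    using \<open>finite I\<close> \<open>j \<in> I\<close> by (simp add: scaleR_add_left sum.distrib if_distrib[of "\<lambda>t. t *\<^sub>R _"] cong: if_cong)
  ultimately show ?case by (intro exI[of _ "\<lambda>i. r i + (if i = j then c else 0)"]) simp
qed

text \<open>
  Expanding each vector of an orthonormal basis in the family gives coefficients that depend linearly on the
  vector represented, hence boundedly.
\<close>

lemma spanning_family_bounded_coefficients:
  fixes w :: "'i \<Rightarrow> 'a::euclidean_space"
  assumes "finite I" "span (w ` I) = UNIV"
  obtains C where "C > 0" "\<And>m. \<exists>c. (\<forall>i\<in>I. \<bar>c i\<bar> \<le> C * norm m) \<and> (\<Sum>i\<in>I. c i *\<^sub>R w i) = m"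
proof -
  have "\<exists>r. b = (\<Sum>i\<in>I. r i *\<^sub>R w i)" for b
    using assms span_image_sum[of I b w] by auto
  then obtain r where r: "\<And>b. b = (\<Sum>i\<in>I. r b i *\<^sub>R w i)" by metis
  define C where "C = 1 + (\<Sum>b\<in>Basis. \<Sum>i\<in>I. \<bar>r b i\<bar>)"
  show thesis
  proof
    show "C > 0" unfolding C_def by (intro add_pos_nonneg sum_nonneg) auto
    fix m :: 'a
    define c where "c i = (\<Sum>b\<in>Basis. (m \<bullet> b) * r b i)" for i
    have "\<bar>c i\<bar> \<le> C * norm m" if "i \<in> I" for i
    proof -
      have "\<bar>c i\<bar> \<le> (\<Sum>b\<in>Basis. \<bar>m \<bullet> b\<bar> * \<bar>r b i\<bar>)"
        unfolding c_def by (rule order_trans[OF sum_abs]) (simp add: abs_mult)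
      also have "\<dots> \<le> (\<Sum>b\<in>Basis. norm m * (\<Sum>i\<in>I. \<bar>r b i\<bar>))"
        using \<open>finite I\<close> that by (intro sum_mono mult_mono Basis_le_norm member_le_sum) auto
      also have "\<dots> \<le> C * norm m"
        unfolding C_def sum_distrib_left[symmetric] by (simp add: algebra_simps)
      finally show ?thesis .
    qed
    moreover have "(\<Sum>i\<in>I. c i *\<^sub>R w i) = (\<Sum>b\<in>Basis. (m \<bullet> b) *\<^sub>R (\<Sum>i\<in>I. r b i *\<^sub>R w i))"
      unfolding c_def scaleR_sum_left scaleR_sum_right by (subst sum.swap) simp
    then have "(\<Sum>i\<in>I. c i *\<^sub>R w i) = m"
      unfolding r[symmetric] by (simp add: euclidean_representation)
    ultimately show "\<exists>c. (\<forall>i\<in>I. \<bar>c i\<bar> \<le> C * norm m) \<and> (\<Sum>i\<in>I. c i *\<^sub>R w i) = m"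
      by blast
  qed
qed

text \<open>
  The product of the two matrices fixes the increments of \<open>moment_prim\<close>, by the addition rule
  \<open>shift_moment_prim\<close>, and these span the fibre.
\<close>

lemma shift_inverse: "shift x (shift (- x) S) = (S :: 'p::{finite,linorder} fibre)"
proof -
  define w :: "nat \<Rightarrow> 'p fibre" where
    "w i = moment_prim (node CARD('p) (Suc i)) - moment_prim (node CARD('p) i)" for i
  have increment: "shift x (shift (- x) (moment_prim b - moment_prim a)) = (moment_prim b - moment_prim a :: 'p fibre)" for a b
    by (simp only: linear_diff[OF linear_shift] shift_moment_prim add_minus_cancel diff_diff_eq2 diff_add_cancel
         add_diff_cancel_right' diff_diff_eq)
  have w: "shift x (shift (- x) (w i)) = w i" for i
    unfolding w_def by (rule increment)
  have lin: "linear (\<lambda>S :: 'p fibre. shift x (shift (- x) S))"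
    using linear_compose[OF linear_shift linear_shift] by (simp only: o_def)
  have "S \<in> span (w ` {..CARD('p)})"
    using moment_spanning[where 'p='p] unfolding w_def by blast
  then show ?thesis
    by (rule linear_eq_on_span[OF lin linear_ident, rotated]) (use w in blast)
qed

text \<open>
  The deviation of \<open>h\<close> from the horizontal line of slope \<open>c\<close> through \<open>q\<close>, translated so that \<open>q\<close> has abscissa 0
  and then dilated so that \<open>h\<close> has abscissa 1. The first component of \<open>rel_moment c q h\<close> is the mean excess over
  \<open>c\<close> of the slopes of a path from \<open>q\<close> to \<open>h\<close>; the others are higher moments of this excess.
\<close>

definition rel_moment :: "real \<Rightarrow> 'p::{finite,linorder} point \<Rightarrow> 'p point \<Rightarrow> 'p fibre" where
  "rel_moment c q h = dil (1 / (fst h - fst q))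
     (shift (- fst q) (snd h - snd q - c *\<^sub>R (moment_prim (fst h) - moment_prim (fst q))))"

text \<open>
  The equation says that a path with \<open>p + 1\<close> sides of equal abscissa length, the \<open>i\<close>-th of slope
  \<open>c\<^sub>0 + c i\<close>, leads from \<open>q\<close> to \<open>h\<close>; the excess slopes \<open>c i\<close> are bounded by the normalised
  deviation. The constant \<open>C\<close> does not depend on the distance of \<open>q\<close> and \<open>h\<close>, since the whole problem is
  moved to the interval \<open>[0, 1]\<close>; this scale invariance produces a cone.
\<close>

lemma steering:
  obtains C where "C > 0"
    "\<And>c\<^sub>0 (q :: 'p::{finite,linorder} point) h. fst h \<noteq> fst q \<Longrightarrow>
      \<exists>c. (\<forall>i \<le> CARD('p). \<bar>c i\<bar> \<le> C * norm (rel_moment c\<^sub>0 q h)) \<and>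
        snd h = snd q + c\<^sub>0 *\<^sub>R (moment_prim (fst h) - moment_prim (fst q))
          + (\<Sum>i\<le>CARD('p). c i *\<^sub>R (moment_prim (fst q + node CARD('p) (Suc i) * (fst h - fst q))
              - moment_prim (fst q + node CARD('p) i * (fst h - fst q))))"
proof -
  let ?\<theta> = "node CARD('p)"
  obtain C where "C > 0" and C: "\<And>m :: 'p fibre. \<exists>c. (\<forall>i\<in>{..CARD('p)}. \<bar>c i\<bar> \<le> C * norm m) \<and>
     (\<Sum>i\<in>{..CARD('p)}. c i *\<^sub>R (moment_prim (?\<theta> (Suc i)) - moment_prim (?\<theta> i))) = m"
    by (rule spanning_family_bounded_coefficients[OF finite_atMost moment_spanning[where 'p='p]]) (rule that)
  show thesis
  proof (rule that[OF \<open>C > 0\<close>])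
    fix c\<^sub>0 and q h :: "'p point"
    assume neq: "fst h \<noteq> fst q"
    define R where "R = snd h - snd q - c\<^sub>0 *\<^sub>R (moment_prim (fst h) - moment_prim (fst q))"
    define l where "l = fst h - fst q"
    obtain c where c: "\<forall>i\<in>{..CARD('p)}. \<bar>c i\<bar> \<le> C * norm (rel_moment c\<^sub>0 q h)"
      and sum: "(\<Sum>i\<in>{..CARD('p)}. c i *\<^sub>R (moment_prim (?\<theta> (Suc i)) - moment_prim (?\<theta> i))) = rel_moment c\<^sub>0 q h"
      using C by blast
    have increment: "shift (fst q) (dil l (r *\<^sub>R (moment_prim b - moment_prim a)))
        = (r *\<^sub>R (moment_prim (fst q + b * l) - moment_prim (fst q + a * l)) :: 'p fibre)" for a b r
      by (simp only: linear_diff[OF linear_shift] linear_diff[OF linear_dil] linear_cmul[OF linear_dil]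
          linear_cmul[OF linear_shift] shift_moment_prim dil_moment_prim mult.commute[of l] diff_diff_eq2 diff_add_cancel)
    have "R = shift (fst q) (dil l (rel_moment c\<^sub>0 q h))"
      using neq by (simp add: rel_moment_def R_def[symmetric] l_def dil_dil shift_inverse)
    also have "\<dots> = (\<Sum>i\<le>CARD('p). c i *\<^sub>R (moment_prim (fst q + ?\<theta> (Suc i) * l) - moment_prim (fst q + ?\<theta> i * l)))"
      unfolding sum[symmetric] linear_sum[OF linear_dil] linear_sum[OF linear_shift] increment ..
    finally have "snd h = snd q + c\<^sub>0 *\<^sub>R (moment_prim (fst h) - moment_prim (fst q))
        + (\<Sum>i\<le>CARD('p). c i *\<^sub>R (moment_prim (fst q + ?\<theta> (Suc i) * l) - moment_prim (fst q + ?\<theta> i * l)))"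
      unfolding R_def by (simp only: diff_eq_eq ac_simps)
    then show "\<exists>c. (\<forall>i \<le> CARD('p). \<bar>c i\<bar> \<le> C * norm (rel_moment c\<^sub>0 q h)) \<and>
        snd h = snd q + c\<^sub>0 *\<^sub>R (moment_prim (fst h) - moment_prim (fst q))
          + (\<Sum>i\<le>CARD('p). c i *\<^sub>R (moment_prim (fst q + ?\<theta> (Suc i) * (fst h - fst q))
              - moment_prim (fst q + ?\<theta> i * (fst h - fst q))))"
      using c unfolding l_def by (intro exI[of _ c]) blast
  qed
qed

section \<open>An open region inside a horizontally convex set\<close>

lemma continuous_on_shift [continuous_intros]:
  fixes g :: "'a::topological_space \<Rightarrow> 'p::{finite,linorder} fibre"
  assumes "continuous_on S f" "continuous_on S g"
  shows "continuous_on S (\<lambda>z. shift (f z) (g z))"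
  unfolding shift_def using assms by (auto intro!: continuous_intros continuous_on_vec_lambda)

lemma continuous_on_dil [continuous_intros]:
  fixes g :: "'a::topological_space \<Rightarrow> 'p::{finite,linorder} fibre"
  assumes "continuous_on S f" "continuous_on S g"
  shows "continuous_on S (\<lambda>z. dil (f z) (g z))"
  unfolding dil_def using assms by (auto intro!: continuous_intros continuous_on_vec_lambda)

lemma continuous_on_moment_prim [continuous_intros]:
  assumes "continuous_on S f"
  shows "continuous_on S (\<lambda>z. moment_prim (f z) :: 'p::{finite,linorder} fibre)"
  unfolding moment_prim_def using assms by (auto intro!: continuous_intros continuous_on_vec_lambda)

lemma continuous_on_moment [continuous_intros]:
  assumes "continuous_on S f"
  shows "continuous_on S (\<lambda>z. moment (f z) :: 'p::{finite,linorder} fibre)"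
  unfolding moment_def using assms by (auto intro!: continuous_intros continuous_on_vec_lambda)

lemma continuous_on_rel_moment:
  "continuous_on {(q, h). fst q \<noteq> fst h} (\<lambda>(q, h). rel_moment c q (h :: 'p::{finite,linorder} point))"
  unfolding rel_moment_def case_prod_beta by (intro continuous_intros) auto

lemma isCont_rel_moment:
  fixes q h :: "'p::{finite,linorder} point"
  assumes "fst q \<noteq> fst h"
  shows "isCont (\<lambda>(q, h). rel_moment c q h) (q, h)"
proof -
  have "open {(q :: 'p point, h :: 'p point). fst q \<noteq> fst h}"
    unfolding case_prod_beta by (intro open_Collect_neq continuous_intros)
  then have "\<forall>z\<in>{(q, h). fst q \<noteq> fst h}. isCont (\<lambda>(q, h). rel_moment c q (h :: 'p point)) z"
    using continuous_on_rel_moment continuous_on_eq_continuous_at by blast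
  then show ?thesis by (rule bspec) (simp add: assms)
qed

lemma node_0 [simp]: "node n 0 = 0"
  by (simp add: node_def)

lemma node_last [simp]: "node n (Suc n) = 1"
  by (simp add: node_def)

lemma node_mono: "i \<le> j \<Longrightarrow> node n i \<le> node n j"
  by (simp add: node_def divide_right_mono)

lemma node_in_unit: "i \<le> Suc n \<Longrightarrow> 0 \<le> node n i \<and> node n i \<le> 1"
  using node_mono[of 0 i n] node_mono[of i "Suc n" n] by simp

text \<open>
  The point dividing the segment from \<open>a\<close> to \<open>b\<close> at a later ratio lies between the point at an earlier ratio and any
  \<open>e\<close> beyond \<open>b\<close>. This orders the vertices of a polygonal path regardless of the sign of \<open>b - a\<close>.
\<close>

lemma ray_between:
  fixes a b r s t :: real
  assumes "b \<in> closed_segment a e" "0 \<le> s" "s \<le> t" "t \<le> 1"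
  shows "a + t * (b - a) \<in> closed_segment (a + s * (b - a)) e"
proof (cases "a \<le> e")
  case True
  then have b: "a \<le> b" "b \<le> e" using assms(1) by (auto simp: closed_segment_eq_real_ivl)
  have "s * (b - a) \<le> t * (b - a)" "t * (b - a) \<le> 1 * (b - a)"
    by (intro mult_right_mono; use b assms in simp)+
  then show ?thesis using b by (simp add: closed_segment_eq_real_ivl)
next
  case False
  then have b: "b \<le> a" "e \<le> b" using assms(1) by (auto simp: closed_segment_eq_real_ivl)
  have "s * (a - b) \<le> t * (a - b)" "t * (a - b) \<le> 1 * (a - b)"
    by (intro mult_right_mono; use b assms in simp)+
  then show ?thesis using b by (auto simp: closed_segment_eq_real_ivl algebra_simps)
qed

lemma moment_prim_bounded:
  obtains M where "M > 0"
    "\<And>a b. \<bar>a\<bar> \<le> R \<Longrightarrow> \<bar>b\<bar> \<le> R \<Longrightarrow> norm (moment_prim a - moment_prim b :: 'p::{finite,linorder} fibre) \<le> M"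
proof -
  have "compact (moment_prim ` {- R..R} :: 'p fibre set)"
    by (intro compact_continuous_image continuous_intros) auto
  then obtain K where K: "\<And>y. y \<in> (moment_prim ` {- R..R} :: 'p fibre set) \<Longrightarrow> norm y \<le> K" and "K > 0"
    using compact_imp_bounded bounded_pos by metis
  show thesis
  proof (rule that[of "2 * K"])
    fix a b assume "\<bar>a\<bar> \<le> R" "\<bar>b\<bar> \<le> R"
    then have "norm (moment_prim a :: 'p fibre) \<le> K" "norm (moment_prim b :: 'p fibre) \<le> K"
      by (auto intro!: K imageI)
    then show "norm (moment_prim a - moment_prim b :: 'p fibre) \<le> 2 * K"
      using norm_triangle_ineq4[of "moment_prim a :: 'p fibre" "moment_prim b"] by linarith
  qed (use \<open>K > 0\<close> in simp)
qed

text \<open>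
  Prolonging the path from its \<open>i\<close>-th vertex to abscissa \<open>x\<^sub>1\<close> changes the endpoint of the line of slope
  \<open>c\<^sub>0\<close> by \<open>i + 1\<close> terms, each at most \<open>\<delta> M\<close>. For small \<open>\<delta>\<close> all these endpoints are therefore within \<open>r\<close> of
  \<open>e\<close>, as \<open>polygonal_path\<close> requires.
\<close>

lemma reachable_in_set:
  fixes T e :: "'p::{finite,linorder} fibre"
  assumes A: "horizontally_convex A" and q: "(x, T) \<in> A" 
    and h: "x' \<in> closed_segment x x\<^sub>1"
    and goal: "\<And>S. dist S e < r \<Longrightarrow> (x\<^sub>1, S) \<in> A"
    and near: "dist (T + c\<^sub>0 *\<^sub>R (moment_prim x\<^sub>1 - moment_prim x)) e < r / 2"
    and M: "\<And>a b. a \<in> closed_segment x x\<^sub>1 \<Longrightarrow> b \<in> closed_segment x x\<^sub>1 \<Longrightarrow>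
      norm (moment_prim a - moment_prim b :: 'p fibre) \<le> M"
    and c: "\<And>i. i \<le> n \<Longrightarrow> \<bar>c i\<bar> \<le> \<delta>" and \<delta>: "real (Suc n) * (\<delta> * M) \<le> r / 2"
  shows "(x', T + c\<^sub>0 *\<^sub>R (moment_prim x' - moment_prim x)
      + (\<Sum>i\<le>n. c i *\<^sub>R (moment_prim (x + node n (Suc i) * (x' - x)) - moment_prim (x + node n i * (x' - x))))) \<in> A"
proof -
  define \<xi> where "\<xi> i = x + node n i * (x' - x)" for i
  have \<xi>_ends: "\<xi> 0 = x" "\<xi> (Suc n) = x'" by (simp_all add: \<xi>_def)
  have \<xi>_between: "\<xi> (Suc i) \<in> closed_segment (\<xi> i) x\<^sub>1" if "i < Suc n" for i
    unfolding \<xi>_def using that node_in_unit[of i n] node_in_unit[of "Suc i" n]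
    by (intro ray_between h node_mono) auto
  have \<xi>_mem: "\<xi> i \<in> closed_segment x x\<^sub>1" if "i \<le> Suc n" for i
    using ray_between[OF h, of 0 "node n i"] node_in_unit[OF that] by (simp add: \<xi>_def)
  define P where "P i = T + c\<^sub>0 *\<^sub>R (moment_prim (\<xi> i) - moment_prim (\<xi> 0))
     + (\<Sum>j<i. c j *\<^sub>R (moment_prim (\<xi> (Suc j)) - moment_prim (\<xi> j)))" for i
  have "0 \<le> \<delta>" using c[of 0] by simp
  have step: "norm (c j *\<^sub>R (moment_prim a - moment_prim b) :: 'p fibre) \<le> \<delta> * M"
    if "j \<le> n" "a \<in> closed_segment x x\<^sub>1" "b \<in> closed_segment x x\<^sub>1" for j a b
    using mult_mono[OF c[OF that(1)] M[OF that(2,3)] \<open>0 \<le> \<delta>\<close>] by simp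
  have aim: "(x\<^sub>1, P i + (c\<^sub>0 + c i) *\<^sub>R (moment_prim x\<^sub>1 - moment_prim (\<xi> i))) \<in> A" if "i < Suc n" for i
  proof (rule goal)
    \<comment> \<open>The change of the endpoint caused by the excess slopes.\<close>
    define E where "E = (\<Sum>j<i. c j *\<^sub>R (moment_prim (\<xi> (Suc j)) - moment_prim (\<xi> j))) + c i *\<^sub>R (moment_prim x\<^sub>1 - moment_prim (\<xi> i) :: 'p fibre)"
    have "norm E \<le> real i * (\<delta> * M) + \<delta> * M"
      unfolding E_def
    proof (rule norm_triangle_mono)
      have "norm (\<Sum>j<i. c j *\<^sub>R (moment_prim (\<xi> (Suc j)) - moment_prim (\<xi> j) :: 'p fibre)) \<le> of_nat (card {..<i}) * (\<delta> * M)"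
        using that by (intro sum_norm_bound step \<xi>_mem) auto
      then show "norm (\<Sum>j<i. c j *\<^sub>R (moment_prim (\<xi> (Suc j)) - moment_prim (\<xi> j) :: 'p fibre)) \<le> real i * (\<delta> * M)" by simp
    next
      show "norm (c i *\<^sub>R (moment_prim x\<^sub>1 - moment_prim (\<xi> i)) :: 'p fibre) \<le> \<delta> * M"
        using that by (intro step \<xi>_mem ends_in_segment) auto
    qed
    also have "\<dots> = real (Suc i) * (\<delta> * M)" by (simp add: algebra_simps)
    also have "\<dots> \<le> real (Suc n) * (\<delta> * M)"
      using that M[of x x] \<open>0 \<le> \<delta>\<close> by (intro mult_right_mono) auto
    finally have "norm E \<le> r / 2" using \<delta> by linarith
    moreover define a where "a = T + c\<^sub>0 *\<^sub>R (moment_prim x\<^sub>1 - moment_prim x)"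
    moreover have "P i + (c\<^sub>0 + c i) *\<^sub>R (moment_prim x\<^sub>1 - moment_prim (\<xi> i)) = a + E"
      by (simp add: P_def E_def a_def \<xi>_ends algebra_simps)
    moreover have "norm (a + E - e) \<le> norm (a - e) + norm E"
      using norm_triangle_ineq[of "a - e" E] by (simp add: algebra_simps)
    ultimately show "dist (P i + (c\<^sub>0 + c i) *\<^sub>R (moment_prim x\<^sub>1 - moment_prim (\<xi> i))) e < r"
      using near by (simp add: dist_norm)
  qed
  have "(\<xi> (Suc n), P (Suc n)) \<in> A"
    unfolding P_def
    by (rule polygonal_path[OF A _ \<xi>_between aim[unfolded P_def]]) (use q in \<open>auto simp: \<xi>_ends\<close>)
  then show ?thesis
    unfolding P_def \<xi>_ends lessThan_Suc_atMost unfolding \<xi>_def .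
qed

text \<open>
  For a given \<open>h\<close>, a point \<open>q\<close> of \<open>A\<close> close enough to \<open>(x\<^sub>0, T\<^sub>0)\<close> satisfies the same strict inequality for the
  deviation of \<open>h\<close>, and \<open>h\<close> is reached from \<open>q\<close> inside \<open>A\<close>. How close \<open>q\<close> must be depends on \<open>h\<close>, but \<open>\<eta>\<close>
  does not: it is fixed by the room available at abscissa \<open>x\<^sub>1\<close>.
\<close>

lemma cone_region:
  fixes T\<^sub>0 :: "'p::{finite,linorder} fibre"
  assumes A: "horizontally_convex A" and q: "(x\<^sub>0, T\<^sub>0) \<in> closure A"
    and e: "(x\<^sub>1, T\<^sub>0 + c\<^sub>0 *\<^sub>R (moment_prim x\<^sub>1 - moment_prim x\<^sub>0)) \<in> interior A"
  obtains \<eta> where "\<eta> > 0"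
    "{h. fst h \<in> open_segment x\<^sub>0 x\<^sub>1 \<and> norm (rel_moment c\<^sub>0 (x\<^sub>0, T\<^sub>0) h) < \<eta>} \<subseteq> interior A"
proof -
  let ?e = "T\<^sub>0 + c\<^sub>0 *\<^sub>R (moment_prim x\<^sub>1 - moment_prim x\<^sub>0)"
  obtain r where "r > 0" and r: "ball (x\<^sub>1, ?e) r \<subseteq> A"
    using e mem_interior by blast
  then have goal: "(x\<^sub>1, S) \<in> A" if "dist S ?e < r" for S
    using that by (auto simp: dist_Pair_Pair dist_commute)
  obtain M where "M > 0" and M: "\<And>a b. \<bar>a\<bar> \<le> \<bar>x\<^sub>0\<bar> + \<bar>x\<^sub>1\<bar> + 1 \<Longrightarrow> \<bar>b\<bar> \<le> \<bar>x\<^sub>0\<bar> + \<bar>x\<^sub>1\<bar> + 1 \<Longrightarrow>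
      norm (moment_prim a - moment_prim b :: 'p fibre) \<le> M"
    using moment_prim_bounded by blast
  obtain C where "C > 0" and C: "\<And>c\<^sub>0 (q :: 'p point) h. fst h \<noteq> fst q \<Longrightarrow>
      \<exists>c. (\<forall>i \<le> CARD('p). \<bar>c i\<bar> \<le> C * norm (rel_moment c\<^sub>0 q h)) \<and>
        snd h = snd q + c\<^sub>0 *\<^sub>R (moment_prim (fst h) - moment_prim (fst q))
          + (\<Sum>i\<le>CARD('p). c i *\<^sub>R (moment_prim (fst q + node CARD('p) (Suc i) * (fst h - fst q))
              - moment_prim (fst q + node CARD('p) i * (fst h - fst q))))"
    using steering by blast
  define \<delta> where "\<delta> = r / (2 * real (Suc CARD('p)) * M)"
  define \<eta> where "\<eta> = \<delta> / C"
  have "\<delta> > 0" unfolding \<delta>_def using \<open>r > 0\<close> \<open>M > 0\<close> by (intro divide_pos_pos mult_pos_pos) auto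
  have \<delta>: "real (Suc CARD('p)) * (\<delta> * M) \<le> r / 2"
    unfolding \<delta>_def using \<open>M > 0\<close> by (simp add: field_simps del: of_nat_Suc)
  let ?O = "{h. fst h \<in> open_segment x\<^sub>0 x\<^sub>1 \<and> norm (rel_moment c\<^sub>0 (x\<^sub>0, T\<^sub>0) h) < \<eta>}"
  have "?O \<subseteq> A"
  proof
    fix h assume "h \<in> ?O"
    then have h: "fst h \<in> open_segment x\<^sub>0 x\<^sub>1" and small: "norm (rel_moment c\<^sub>0 (x\<^sub>0, T\<^sub>0) h) < \<eta>" by auto
    have neq: "fst h \<noteq> x\<^sub>0" using h by (auto simp: open_segment_def)
    obtain f where f: "\<And>k. f k \<in> A" "f \<longlonglongrightarrow> (x\<^sub>0, T\<^sub>0)"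
      using q closure_sequential by blast
    have lim1: "(\<lambda>k. fst (f k)) \<longlonglongrightarrow> x\<^sub>0" and lim2: "(\<lambda>k. snd (f k)) \<longlonglongrightarrow> T\<^sub>0"
      using tendsto_fst[OF f(2)] tendsto_snd[OF f(2)] by simp_all
    have "(\<lambda>k. rel_moment c\<^sub>0 (f k) h) \<longlonglongrightarrow> rel_moment c\<^sub>0 (x\<^sub>0, T\<^sub>0) h"
      using isCont_tendsto_compose[OF isCont_rel_moment tendsto_Pair[OF f(2) tendsto_const]] neq by simp
    then have ev1: "\<forall>\<^sub>F k in sequentially. norm (rel_moment c\<^sub>0 (f k) h) < \<eta>"
      using small by (intro order_tendstoD(2)[OF tendsto_norm])
    have "(\<lambda>k. dist (snd (f k) + c\<^sub>0 *\<^sub>R (moment_prim x\<^sub>1 - moment_prim (fst (f k)))) ?e) \<longlonglongrightarrow> dist ?e ?e"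
      by (intro tendsto_intros lim2 isCont_tendsto_compose[OF _ lim1, of moment_prim]
          has_vector_derivative_continuous[OF moment_prim_deriv])
    then have ev2: "\<forall>\<^sub>F k in sequentially. dist (snd (f k) + c\<^sub>0 *\<^sub>R (moment_prim x\<^sub>1 - moment_prim (fst (f k)))) ?e < r / 2"
      using \<open>r > 0\<close> by (intro order_tendstoD(2)) auto
    have ev3: "\<forall>\<^sub>F k in sequentially. dist (fst (f k)) x\<^sub>0 < min 1 (dist (fst h) x\<^sub>0)"
      using neq by (intro tendstoD[OF lim1]) auto
    obtain k where k: "norm (rel_moment c\<^sub>0 (f k) h) < \<eta>"
      "dist (snd (f k) + c\<^sub>0 *\<^sub>R (moment_prim x\<^sub>1 - moment_prim (fst (f k)))) ?e < r / 2"
      "dist (fst (f k)) x\<^sub>0 < min 1 (dist (fst h) x\<^sub>0)"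
      using eventually_happens'[OF sequentially_bot eventually_conj[OF ev1 eventually_conj[OF ev2 ev3]]] by blast
    have between: "fst h \<in> closed_segment (fst (f k)) x\<^sub>1"
      using h k(3) by (auto simp: open_segment_eq_real_ivl closed_segment_eq_real_ivl dist_real_def split: if_splits)
    have neq': "fst h \<noteq> fst (f k)" using k(3) by auto
    obtain c where c: "\<And>i. i \<le> CARD('p) \<Longrightarrow> \<bar>c i\<bar> \<le> C * norm (rel_moment c\<^sub>0 (f k) h)"
      and eq: "snd h = snd (f k) + c\<^sub>0 *\<^sub>R (moment_prim (fst h) - moment_prim (fst (f k)))
          + (\<Sum>i\<le>CARD('p). c i *\<^sub>R (moment_prim (fst (f k) + node CARD('p) (Suc i) * (fst h - fst (f k)))
              - moment_prim (fst (f k) + node CARD('p) i * (fst h - fst (f k)))))"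
      using C[OF neq'] by blast
    have c\<delta>: "\<bar>c i\<bar> \<le> \<delta>" if "i \<le> CARD('p)" for i
    proof -
      have "C * norm (rel_moment c\<^sub>0 (f k) h) \<le> C * \<eta>" using k(1) \<open>C > 0\<close> by simp
      then show ?thesis using c[OF that] \<open>C > 0\<close> by (simp add: \<eta>_def)
    qed
    have "(fst h, snd h) \<in> A"
      unfolding eq
    proof (rule reachable_in_set[OF A _ between goal k(2) _ c\<delta> \<delta>])
      show "(fst (f k), snd (f k)) \<in> A" using f(1)[of k] by simp
      fix a b assume "a \<in> closed_segment (fst (f k)) x\<^sub>1" "b \<in> closed_segment (fst (f k)) x\<^sub>1"
      then show "norm (moment_prim a - moment_prim b :: 'p fibre) \<le> M"
        using k(3) by (intro M) (auto simp: closed_segment_eq_real_ivl dist_real_def split: if_splits)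
    qed
    then show "h \<in> A" by simp
  qed
  moreover have "open ?O"
  proof -
    have "open {h :: 'p point. fst h \<in> open_segment x\<^sub>0 x\<^sub>1}"
      using open_vimage_fst[of "open_segment x\<^sub>0 x\<^sub>1", where 'b="'p fibre"]
      by (simp add: open_segment_eq_real_ivl vimage_def)
    moreover have "continuous_on {h :: 'p point. fst h \<in> open_segment x\<^sub>0 x\<^sub>1} (\<lambda>h. norm (rel_moment c\<^sub>0 (x\<^sub>0, T\<^sub>0) h))"
      unfolding rel_moment_def by (intro continuous_intros) (auto simp: open_segment_def)
    ultimately have "open ((\<lambda>h. norm (rel_moment c\<^sub>0 (x\<^sub>0, T\<^sub>0) h)) -` {..<\<eta>} \<inter> {h. fst h \<in> open_segment x\<^sub>0 x\<^sub>1})"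
      using continuous_on_open_vimage open_lessThan by blast
    also have "\<dots> = ?O" by auto
    finally show ?thesis .
  qed
  ultimately have "?O \<subseteq> interior A" by (rule interior_maximal)
  then show thesis using that[of \<eta>] \<open>\<delta> > 0\<close> \<open>C > 0\<close> by (simp add: \<eta>_def)
qed

section \<open>The fundamental theorem of calculus for Lipschitz curves\<close>

text \<open>
  The difference quotients of \<open>f\<close>, extended by constants beyond \<open>[a, b]\<close>, are bounded by \<open>L\<close> and converge almost
  everywhere to \<open>f'\<close>. Their integrals are differences of difference quotients of a primitive of \<open>f\<close> at the two
  endpoints, so they tend to \<open>f b - f a\<close>; dominated convergence identifies the limit.
\<close>

lemma fundamental_theorem_of_calculus_lipschitz_AE:
  fixes f :: "real \<Rightarrow> 'a::euclidean_space"
  assumes "a \<le> b" and lip: "L-lipschitz_on {a..b} f"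
    and deriv: "AE \<tau> in lebesgue. \<tau> \<in> {a<..<b} \<longrightarrow> (f has_vector_derivative f' \<tau>) (at \<tau>)"
  shows "(f' has_integral f b - f a) {a..b}"
proof -
  define g where "g x = f (max a (min b x))" for x
  have g_lip: "norm (g x - g y) \<le> L * \<bar>x - y\<bar>" for x y
  proof -
    have "norm (g x - g y) \<le> L * norm (max a (min b x) - max a (min b y))"
      unfolding g_def using \<open>a \<le> b\<close> by (intro lipschitz_on_normD[OF lip]) auto
    also have "\<dots> \<le> L * \<bar>x - y\<bar>"
      by (intro mult_left_mono lipschitz_on_nonneg[OF lip]) (auto simp: max_def min_def)
    finally show ?thesis .
  qed
  then have "L-lipschitz_on UNIV g"
    by (intro lipschitz_onI) (auto simp: dist_norm lipschitz_on_nonneg[OF lip])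
  then have g_cont: "continuous_on S g" for S
    by (meson continuous_on_subset lipschitz_on_continuous_on subset_UNIV)
  define G where "G x = integral {a - 1..x} g" for x
  have G_deriv: "(G has_vector_derivative g x) (at x)" if "x \<in> {a..b + 1}" for x
    using integral_has_vector_derivative[OF g_cont, of x "a - 1" "b + 2"] that
      at_within_Icc_at[of "a-1" x "b+2"]
    unfolding G_def by simp
  \<comment> \<open>Step widths at most 1 keep all shifted arguments inside the interval on which \<open>G\<close> is a primitive of \<open>g\<close>.\<close>
  define h where "h n = 1 / real (Suc n)" for n
  have h: "0 < h n" "h n \<le> 1" for n by (auto simp: h_def)
  have h_lim: "h \<longlonglongrightarrow> 0" unfolding h_def by (rule LIMSEQ_Suc[OF lim_1_over_n])
  define D where "D n x = (g (x + h n) - g x) /\<^sub>R h n" for n x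
  define I where "I n = (G (b + h n) - G b) /\<^sub>R h n - (G (a + h n) - G a) /\<^sub>R h n" for n
  obtain N where N: "negligible N"
    and f': "\<And>x. x \<in> {a<..<b} \<Longrightarrow> x \<notin> N \<Longrightarrow> (f has_vector_derivative f' x) (at x)"
    using AE_E3[OF deriv] unfolding negligible_iff_null_sets by (metis DiffI UNIV_I space_completion space_lborel space_borel)
  \<comment> \<open>No derivative of \<open>f\<close> is assumed at the endpoints, so they join the exceptional null set.\<close>
  define M where "M = N \<union> {a, b}"
  have M: "negligible M" unfolding M_def using N by auto
  have int_D: "(D n has_integral I n) {a..b}" for n
  proof -
    have "((\<lambda>x. (G (x + h n) - G x) /\<^sub>R h n) has_vector_derivative D n x) (at x within {a..b})"
      if "x \<in> {a..b}" for x
    proof -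
      have "((\<lambda>x. G (x + h n)) has_vector_derivative g (x + h n)) (at x)"
        using G_deriv[of "x + h n"] that h[of n] vector_diff_chain_at[of "\<lambda>x. x + h n" 1 x G "g (x + h n)"]
        by (simp add: o_def has_vector_derivative_add_const)
      then show ?thesis
        unfolding D_def using that
        by (intro has_vector_derivative_at_within[of _ _ x "{a..b}"]
              bounded_linear.has_vector_derivative[OF bounded_linear_scaleR_right] 
              has_vector_derivative_diff G_deriv) auto
    qed
    from fundamental_theorem_of_calculus[OF \<open>a \<le> b\<close> this] show ?thesis
      unfolding I_def by (simp add: scaleR_diff_right)
  qed
  have quot: "(\<lambda>n. (F (x + h n) - F x) /\<^sub>R h n) \<longlonglongrightarrow> F'"
    if "(F has_vector_derivative F') (at x)" for F :: "real \<Rightarrow> 'a" and F' x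
  proof -
    have "((\<lambda>d. norm (F (x + d) - F x - d *\<^sub>R F') / norm d) \<longlongrightarrow> 0) (at 0)"
      using that unfolding has_vector_derivative_def has_derivative_at by blast
    moreover have "filterlim h (at 0) sequentially"
      unfolding filterlim_at using h(1) h_lim by (simp add: less_imp_neq[symmetric])
    ultimately have "(\<lambda>n. norm (F (x + h n) - F x - h n *\<^sub>R F') / norm (h n)) \<longlonglongrightarrow> 0"
      by (rule filterlim_compose)
    moreover have "norm (F (x + h n) - F x - h n *\<^sub>R F') / norm (h n) = norm ((F (x + h n) - F x) /\<^sub>R h n - F')" for n
    proof -
      have "F (x + h n) - F x - h n *\<^sub>R F' = h n *\<^sub>R ((F (x + h n) - F x) /\<^sub>R h n - F')"
        using h(1)[of n] by (simp add: scaleR_diff_right)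
      then show ?thesis using h(1)[of n] by (simp add: less_imp_neq[symmetric])
    qed
    ultimately have "(\<lambda>n. (F (x + h n) - F x) /\<^sub>R h n - F') \<longlonglongrightarrow> 0"
      by (simp add: tendsto_norm_zero_iff)
    then show ?thesis by (simp add: LIM_zero_iff)
  qed
  have "I \<longlonglongrightarrow> g b - g a"
    unfolding I_def using \<open>a \<le> b\<close> by (intro tendsto_diff quot G_deriv) auto
  then have lim_I: "I \<longlonglongrightarrow> f b - f a" using \<open>a \<le> b\<close> by (simp add: g_def)
  have "((\<lambda>x. if x \<in> M then 0 else f' x) has_integral f b - f a) {a..b}"
  proof (rule has_integral_dominated_convergence)
    show "((\<lambda>x. if x \<in> M then 0 else D n x) has_integral I n) {a..b}" for n
      by (rule has_integral_spike[OF M _ int_D]) auto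
    show "(\<lambda>x. L) integrable_on {a..b}" by (rule integrable_const_ivl)
    show "\<forall>x\<in>{a..b}. norm (if x \<in> M then 0 else D n x) \<le> L" for n
      using g_lip[of "x + h n" x for x] h[of n] lipschitz_on_nonneg[OF lip]
      by (auto simp: D_def inverse_eq_divide pos_divide_le_eq)
    show "\<forall>x\<in>{a..b}. (\<lambda>n. if x \<in> M then 0 else D n x) \<longlonglongrightarrow> (if x \<in> M then 0 else f' x)"
    proof
      fix x assume x: "x \<in> {a..b}"
      show "(\<lambda>n. if x \<in> M then 0 else D n x) \<longlonglongrightarrow> (if x \<in> M then 0 else f' x)"
      proof (cases "x \<in> M")
        case False
        then have x': "x \<in> {a<..<b}" "x \<notin> N" using x by (auto simp: M_def)
        have g_eq: "f y = g y" if "y \<in> {a<..<b}" for y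
          using that by (simp add: g_def max_absorb2 min_absorb2)
        have "(g has_vector_derivative f' x) (at x)"
          by (rule has_vector_derivative_transform_within_open[OF f'[OF x'], of "{a<..<b}"])
             (simp_all only: open_greaterThanLessThan x' g_eq)
        from quot[OF this] show ?thesis using False by (simp add: D_def)
      qed auto
    qed
    show "I \<longlonglongrightarrow> f b - f a" by (rule lim_I)
  qed
  then show ?thesis
    by (rule has_integral_spike[OF M, rotated]) auto
qed

section \<open>Any two points are joined by a horizontal curve\<close>

lemma inner_moment_sq_pos:
  fixes a :: "'p::{finite,linorder} fibre" and g :: "real \<Rightarrow> real"
  assumes g: "continuous_on {0..1} g" and inf: "infinite (g ` {0..1})" and a: "a \<noteq> 0"
  shows "integral {0..1} (\<lambda>\<tau>. (a \<bullet> moment (g \<tau>))\<^sup>2) \<noteq> 0"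
proof
  assume 0: "integral {0..1} (\<lambda>\<tau>. (a \<bullet> moment (g \<tau>))\<^sup>2) = 0"
  have cont: "continuous_on {0..1} (\<lambda>\<tau>. (a \<bullet> moment (g \<tau>))\<^sup>2)"
    by (intro continuous_intros g)
  have "(a \<bullet> moment (g \<tau>))\<^sup>2 = 0" if "\<tau> \<in> {0..1}" for \<tau>
    using has_integral_0_cbox_imp_0[of 0 1 "\<lambda>\<tau>. (a \<bullet> moment (g \<tau>))\<^sup>2" \<tau>] cont 0 that
      integrable_continuous_real[OF cont] by (auto simp: has_integral_integrable_integral)
  then have "g ` {0..1} \<subseteq> {\<xi>. a \<bullet> moment \<xi> = 0}" by auto
  with finite_moment_zeros[OF a] inf show False using finite_subset by blast
qed

text \<open>
  Along an abscissa \<open>g\<close> with infinitely many values, any fibre displacement is produced by a control of the form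
  \<open>a \<bullet> moment (g \<tau>)\<close>: the map from \<open>a\<close> to the displacement is the Gram operator of the curve \<open>moment \<circ> g\<close>,
  which is positive definite because a nonzero polynomial cannot vanish on an infinite set.
\<close>

lemma moment_control:
  fixes S :: "'p::{finite,linorder} fibre" and g :: "real \<Rightarrow> real"
  assumes g: "continuous_on {0..1} g" and inf: "infinite (g ` {0..1})"
  obtains a :: "'p::{finite,linorder} fibre" where "integral {0..1} (\<lambda>\<tau>. (a \<bullet> moment (g \<tau>)) *\<^sub>R moment (g \<tau>)) = S"
proof -
  define G where "G a = integral {0..1} (\<lambda>\<tau>. (a \<bullet> moment (g \<tau>)) *\<^sub>R moment (g \<tau>) :: 'p fibre)" for a :: "'p fibre"
  have int: "(\<lambda>\<tau>. (a \<bullet> moment (g \<tau>)) *\<^sub>R moment (g \<tau>) :: 'p fibre) integrable_on {0..1}" for a :: "'p fibre"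
    by (intro integrable_continuous_real continuous_intros g)
  have lin: "linear G"
  proof (rule linearI)
    show "G (a + b) = G a + G b" for a b
      unfolding G_def inner_add_left scaleR_add_left by (intro integral_add int)
    show "G (r *\<^sub>R a) = r *\<^sub>R G a" for r a
      unfolding G_def inner_scaleR_left by (simp flip: scaleR_scaleR)
  qed
  have "inj G"
    unfolding linear_injective_0[OF lin]
  proof (intro allI impI)
    fix a :: "'p fibre" assume "G a = 0"
    have "a \<bullet> G a = integral {0..1} (\<lambda>\<tau>. a \<bullet> ((a \<bullet> moment (g \<tau>)) *\<^sub>R moment (g \<tau>)))"
      unfolding G_def using integral_linear[OF int bounded_linear_inner_right[of a]] by (simp add: o_def)
    also have "\<dots> = integral {0..1} (\<lambda>\<tau>. (a \<bullet> moment (g \<tau>))\<^sup>2)"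
      by (simp add: power2_eq_square)
    finally show "a = 0" using inner_moment_sq_pos[OF g inf, of a] \<open>G a = 0\<close> by auto
  qed
  then have "surj G" by (rule linear_injective_imp_surjective[OF lin]) (rule refl)
  then obtain a where "S = G a" by (rule surjE)
  then show thesis by (intro that[of a]) (simp only: G_def)
qed

lemma infinite_image_continuous:
  fixes g :: "real \<Rightarrow> real"
  assumes g: "continuous_on {0..1} g" and neq: "g s \<noteq> g t" "s \<in> {0..1}" "t \<in> {0..1}"
  shows "infinite (g ` {0..1})"
proof -
  have "connected (g ` {0..1})" using g by (intro connected_continuous_image) auto
  then show ?thesis using connected_finite_iff_sing neq by (metis imageI empty_iff singletonD)
qed

text \<open>
  The abscissa is prescribed and the fibre displacement is then adjusted by \<open>moment_control\<close>. The abscissa must not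
  be constant, so a bump \<open>\<tau> (1 - \<tau>)\<close> is added when both endpoints have the same abscissa.
\<close>

lemma horizontal_curve_exists:
  fixes g h :: "'p::{finite,linorder} point"
  obtains \<gamma> w where "horizontal_curve 0 1 \<gamma> w" "\<gamma> 0 = g" "\<gamma> 1 = h"
proof -
  define m where "m = (if fst h = fst g then 1 else 0 :: real)"
  define x where "x \<tau> = fst g + \<tau> * (fst h - fst g) + m * (\<tau> * (1 - \<tau>))" for \<tau>
  define x' where "x' \<tau> = (fst h - fst g) + m * (1 - 2 * \<tau>)" for \<tau>
  have x_deriv: "(x has_vector_derivative x' \<tau>) (at \<tau> within S)" for \<tau> S
    unfolding x_def x'_def has_real_derivative_iff_has_vector_derivative[symmetric]
    by (auto intro!: derivative_eq_intros simp: algebra_simps)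
  have x_cont: "continuous_on S x" for S unfolding x_def by (intro continuous_intros)
  have "infinite (x ` {0..1})"
  proof (cases "fst h = fst g")
    case True
    then show ?thesis by (intro infinite_image_continuous[OF x_cont, of 0 "1/2"]) (auto simp: x_def m_def)
  next
    case False
    then show ?thesis by (intro infinite_image_continuous[OF x_cont, of 0 1]) (auto simp: x_def m_def)
  qed
  from moment_control[OF x_cont this, of "snd h - snd g"] obtain a :: "'p fibre" where
    a: "integral {0..1} (\<lambda>\<tau>. (a \<bullet> moment (x \<tau>)) *\<^sub>R moment (x \<tau>)) = snd h - snd g" .
  define T' :: "real \<Rightarrow> 'p fibre" where "T' \<tau> = (a \<bullet> moment (x \<tau>)) *\<^sub>R moment (x \<tau>)" for \<tau>
  have T'_cont: "continuous_on S T'" for S unfolding T'_def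
    by (intro continuous_on_scaleR continuous_on_inner continuous_on_const continuous_on_moment x_cont)
  define \<gamma> where "\<gamma> \<tau> = (x \<tau>, snd g + integral {0..\<tau>} T')" for \<tau>
  define w where "w \<tau> = (x' \<tau>, a \<bullet> moment (x \<tau>))" for \<tau>
  have deriv: "(\<gamma> has_vector_derivative (x' \<tau>, T' \<tau>)) (at \<tau> within {0..1})" if "\<tau> \<in> {0..1}" for \<tau>
  proof -
    have "((\<lambda>\<tau>. snd g + integral {0..\<tau>} T') has_vector_derivative 0 + T' \<tau>) (at \<tau> within {0..1})"
      by (intro has_vector_derivative_add has_vector_derivative_const integral_has_vector_derivative[OF T'_cont that])
    then show ?thesis
      unfolding \<gamma>_def add_0 by (intro has_vector_derivative_Pair x_deriv)
  qed
  have "horizontal_curve 0 1 \<gamma> w"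
    unfolding horizontal_curve_def
  proof (intro conjI)
    have "continuous_on {0..1} (\<lambda>\<tau>. (x' \<tau>, T' \<tau>))"
      unfolding x'_def by (intro continuous_intros T'_cont)
    then have "bounded ((\<lambda>\<tau>. (x' \<tau>, T' \<tau>)) ` {0..1})"
      by (intro compact_imp_bounded compact_continuous_image) auto
    then obtain K where K: "\<And>\<tau>. \<tau> \<in> {0..1} \<Longrightarrow> norm (x' \<tau>, T' \<tau>) \<le> K" and "K > 0"
      using bounded_pos by (metis (no_types, lifting) image_eqI)
    have "norm (\<gamma> \<sigma> - \<gamma> \<tau>) \<le> K * norm (\<sigma> - \<tau>)" if "\<sigma> \<in> {0..1}" "\<tau> \<in> {0..1}" for \<sigma> \<tau>
    proof (rule differentiable_bound[OF convex_real_interval(5) _ _ that])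
      show "(\<gamma> has_derivative (\<lambda>r. r *\<^sub>R (x' \<tau>, T' \<tau>))) (at \<tau> within {0..1})" if "\<tau> \<in> {0..1}" for \<tau>
        using deriv[OF that] unfolding has_vector_derivative_def .
      show "onorm (\<lambda>r. r *\<^sub>R (x' \<tau>, T' \<tau>)) \<le> K" if "\<tau> \<in> {0..1}" for \<tau>
      proof (rule onorm_bound)
        show "norm (r *\<^sub>R (x' \<tau>, T' \<tau>)) \<le> K * norm r" for r
          unfolding norm_scaleR real_norm_def mult.commute[of K]
          by (rule mult_left_mono[OF K[OF that]]) simp
      qed (use \<open>K > 0\<close> in simp)
    qed
    then show "\<exists>L. L-lipschitz_on {0..1} \<gamma>"
      using \<open>K > 0\<close> by (intro exI[of _ K] lipschitz_onI) (auto simp: dist_norm)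
    have "w absolutely_integrable_on {0..1}"
      unfolding w_def x'_def by (intro absolutely_integrable_continuous_real continuous_intros x_cont)
    then show "w absolutely_integrable_on {0<..<1}"
      by (rule absolutely_integrable_on_Icc_iff_Ioo[THEN iffD1])
    show "AE \<tau> in lebesgue. \<tau> \<in> {0<..<1} \<longrightarrow>
        (\<gamma> has_vector_derivative (fst (w \<tau>) *\<^sub>R X_field (\<gamma> \<tau>) + snd (w \<tau>) *\<^sub>R Y_field (\<gamma> \<tau>))) (at \<tau>)"
    proof (intro AE_I2 impI)
      fix \<tau> :: real assume \<tau>: "\<tau> \<in> {0<..<1}"
      then have "(\<gamma> has_vector_derivative (x' \<tau>, T' \<tau>)) (at \<tau>)"
        using deriv[of \<tau>] at_within_Icc_at[of 0 \<tau> 1] by simp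
      moreover have "fst (w \<tau>) *\<^sub>R X_field (\<gamma> \<tau>) + snd (w \<tau>) *\<^sub>R Y_field (\<gamma> \<tau>) = (x' \<tau>, T' \<tau>)"
        by (simp add: \<gamma>_def X_field_eq Y_field_eq w_def T'_def)
      ultimately show "(\<gamma> has_vector_derivative (fst (w \<tau>) *\<^sub>R X_field (\<gamma> \<tau>) + snd (w \<tau>) *\<^sub>R Y_field (\<gamma> \<tau>))) (at \<tau>)"
        by simp
    qed
  qed
  moreover have "\<gamma> 0 = g" by (simp add: \<gamma>_def x_def)
  moreover have "\<gamma> 1 = h" using a by (simp add: \<gamma>_def x_def T'_def[abs_def])
  ultimately show thesis by (rule that)
qed

section \<open>Small subriemannian balls\<close>

text \<open>
  Only for a nonempty set does an infimum below \<open>r\<close> yield an element below \<open>r\<close>; this is where the existence of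
  horizontal curves enters.
\<close>

lemma sr_ball_curve:
  assumes "h \<in> sr_ball g r"
  obtains a b \<gamma> w where "a < b" "horizontal_curve a b \<gamma> w" "\<gamma> a = g" "\<gamma> b = h"
    "integral {a<..<b} (\<lambda>\<tau>. norm (w \<tau>)) < r"
proof -
  let ?S = "{integral {a<..<b} (\<lambda>\<tau>. norm (w \<tau>)) | a b \<gamma> w.
            a < b \<and> horizontal_curve a b \<gamma> w \<and> \<gamma> a = g \<and> \<gamma> b = h}"
  obtain \<gamma> w where \<gamma>: "horizontal_curve 0 1 \<gamma> w" "\<gamma> 0 = g" "\<gamma> 1 = h"
    by (rule horizontal_curve_exists)
  have "integral {0<..<1} (\<lambda>\<tau>. norm (w \<tau>)) \<in> ?S"
    unfolding mem_Collect_eq using \<gamma> zero_less_one by blast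
  then have "?S \<noteq> {}" by blast
  moreover have "Inf ?S < r" using assms by (simp add: sr_ball_def sr_dist_def)
  ultimately obtain l where "l \<in> ?S" "l < r" by (rule cInf_lessD[THEN bexE])
  then show thesis using that by blast
qed

lemma horizontal_curve_displacement:
  fixes \<gamma> :: "real \<Rightarrow> 'p::{finite,linorder} point"
  assumes \<gamma>: "horizontal_curve a b \<gamma> w" and c: "c \<in> {a..b}"
  shows "((\<lambda>\<tau>. fst (w \<tau>)) has_integral fst (\<gamma> c) - fst (\<gamma> a)) {a..c}"
    and "((\<lambda>\<tau>. snd (w \<tau>) *\<^sub>R moment (fst (\<gamma> \<tau>))) has_integral snd (\<gamma> c) - snd (\<gamma> a)) {a..c}"
proof -
  let ?V = "\<lambda>\<tau>. (fst (w \<tau>), snd (w \<tau>) *\<^sub>R moment (fst (\<gamma> \<tau>))) :: 'p point"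
  obtain L where L: "L-lipschitz_on {a..b} \<gamma>" using \<gamma> unfolding horizontal_curve_def by blast
  have field: "fst (w \<tau>) *\<^sub>R X_field (\<gamma> \<tau>) + snd (w \<tau>) *\<^sub>R Y_field (\<gamma> \<tau>) = ?V \<tau>" for \<tau>
    by (cases "\<gamma> \<tau>") (simp only: X_field_eq Y_field_eq fst_conv scaleR_Pair add_Pair scaleR_zero_right, simp)
  have "AE \<tau> in lebesgue. \<tau> \<in> {a<..<b} \<longrightarrow> (\<gamma> has_vector_derivative ?V \<tau>) (at \<tau>)"
    using \<gamma> unfolding horizontal_curve_def field by blast
  then have "AE \<tau> in lebesgue. \<tau> \<in> {a<..<c} \<longrightarrow> (\<gamma> has_vector_derivative ?V \<tau>) (at \<tau>)"
    by (rule eventually_mono) (use c in auto)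
  then have "(?V has_integral \<gamma> c - \<gamma> a) {a..c}"
    using c by (intro fundamental_theorem_of_calculus_lipschitz_AE[of a c L] lipschitz_on_subset[OF L]) auto
  from has_integral_linear[OF this bounded_linear_fst] has_integral_linear[OF this bounded_linear_snd]
  show "((\<lambda>\<tau>. fst (w \<tau>)) has_integral fst (\<gamma> c) - fst (\<gamma> a)) {a..c}"
    and "((\<lambda>\<tau>. snd (w \<tau>) *\<^sub>R moment (fst (\<gamma> \<tau>))) has_integral snd (\<gamma> c) - snd (\<gamma> a)) {a..c}"
    by (simp_all add: o_def)
qed

text \<open>
  The abscissa moves by at most the length of the curve. So only the values of \<open>moment\<close> near the initial
  abscissa contribute to the fibre displacement, which can be measured after any linear map \<open>D\<close>; below, \<open>D\<close> is
  the normalisation by translation and dilation.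
\<close>

lemma horizontal_curve_estimate:
  fixes \<gamma> :: "real \<Rightarrow> 'p::{finite,linorder} point" and D :: "'p fibre \<Rightarrow> 'p fibre"
  assumes "a < b" and \<gamma>: "horizontal_curve a b \<gamma> w"
  defines "l \<equiv> integral {a<..<b} (\<lambda>\<tau>. norm (w \<tau>))"
  shows "\<bar>fst (\<gamma> b) - fst (\<gamma> a)\<bar> \<le> l"
    and "linear D \<Longrightarrow> (\<And>\<xi>. \<bar>\<xi> - fst (\<gamma> a)\<bar> \<le> l \<Longrightarrow> norm (D (moment \<xi>)) \<le> K) \<Longrightarrow>
      norm (D (snd (\<gamma> b) - snd (\<gamma> a))) \<le> K * l"
proof -
  have "(\<lambda>\<tau>. norm (w \<tau>)) integrable_on {a<..<b}"
    using \<gamma> unfolding horizontal_curve_def absolutely_integrable_on_def by blast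
  then have int: "(\<lambda>\<tau>. norm (w \<tau>)) integrable_on {a..b}"
    by (simp add: integrable_on_Icc_iff_Ioo)
  have l: "l = integral {a..b} (\<lambda>\<tau>. norm (w \<tau>))"
    unfolding l_def by (rule integral_open_interval_real[symmetric])
  have x: "\<bar>fst (\<gamma> c) - fst (\<gamma> a)\<bar> \<le> l" if c: "c \<in> {a..b}" for c
  proof -
    note D = horizontal_curve_displacement(1)[OF \<gamma> c]
    have intc: "(\<lambda>\<tau>. norm (w \<tau>)) integrable_on {a..c}"
      using c by (intro integrable_on_subinterval[OF int]) auto
    have "norm (integral {a..c} (\<lambda>\<tau>. fst (w \<tau>))) \<le> integral {a..c} (\<lambda>\<tau>. norm (w \<tau>))"
      by (rule integral_norm_bound_integral[OF has_integral_integrable[OF D] intc])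
         (use norm_fst_le[of "fst (w \<tau>)" "snd (w \<tau>)" for \<tau>] in simp)
    also have "\<dots> \<le> l"
      unfolding l using c by (intro integral_subset_le intc int) auto
    finally show ?thesis using integral_unique[OF D] by simp
  qed
  then show "\<bar>fst (\<gamma> b) - fst (\<gamma> a)\<bar> \<le> l" using \<open>a < b\<close> by simp
  assume D: "linear D" and K: "\<And>\<xi>. \<bar>\<xi> - fst (\<gamma> a)\<bar> \<le> l \<Longrightarrow> norm (D (moment \<xi>)) \<le> K"
  have "b \<in> {a..b}" using \<open>a < b\<close> by simp
  from has_integral_linear[OF horizontal_curve_displacement(2)[OF \<gamma> this] D[unfolded linear_conv_bounded_linear]]
  have DT: "((\<lambda>\<tau>. snd (w \<tau>) *\<^sub>R D (moment (fst (\<gamma> \<tau>)))) has_integral D (snd (\<gamma> b) - snd (\<gamma> a))) {a..b}"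
    by (simp add: o_def linear_cmul[OF D])
  have "norm (integral {a..b} (\<lambda>\<tau>. snd (w \<tau>) *\<^sub>R D (moment (fst (\<gamma> \<tau>))))) \<le> integral {a..b} (\<lambda>\<tau>. K * norm (w \<tau>))"
  proof (rule integral_norm_bound_integral[OF has_integral_integrable[OF DT]])
    show "(\<lambda>\<tau>. K * norm (w \<tau>)) integrable_on {a..b}" using integrable_on_cmult_left[OF int, of K] by simp
    fix \<tau> assume "\<tau> \<in> {a..b}"
    then have "norm (D (moment (fst (\<gamma> \<tau>)))) \<le> K" by (intro K x)
    then have "\<bar>snd (w \<tau>)\<bar> * norm (D (moment (fst (\<gamma> \<tau>)))) \<le> norm (w \<tau>) * K"
      using norm_snd_le[of "snd (w \<tau>)" "fst (w \<tau>)"] by (intro mult_mono) auto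
    then show "norm (snd (w \<tau>) *\<^sub>R D (moment (fst (\<gamma> \<tau>)))) \<le> K * norm (w \<tau>)" by (simp add: mult.commute)
  qed
  then show "norm (D (snd (\<gamma> b) - snd (\<gamma> a))) \<le> K * l"
    unfolding integral_unique[OF DT] l by simp
qed

text \<open>
  After translation to abscissa 0 and dilation by \<open>1/s\<close>, the centre of the ball becomes the point of abscissa \<open>u\<close>
  on the line and the radius becomes \<open>\<epsilon>\<close>. So the deviation of \<open>h\<close> is a continuous function \<open>F\<close>,
  independent of \<open>s\<close>, of the normalised abscissa \<open>\<mu>\<close> and of the normalised fibre displacement \<open>e\<close> from the
  centre, and it vanishes at \<open>(u, 0)\<close>.
\<close>

lemma sr_ball_rel_moment:
  fixes T\<^sub>0 :: "'p::{finite,linorder} fibre"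
  assumes "u \<noteq> 0" "\<eta> > 0" "d > 0"
  obtains \<epsilon> where "\<epsilon> > 0"
    "\<And>s h. s > 0 \<Longrightarrow> h \<in> sr_ball (x\<^sub>0 + s * u, T\<^sub>0 + c\<^sub>0 *\<^sub>R (moment_prim (x\<^sub>0 + s * u) - moment_prim x\<^sub>0)) (\<epsilon> * s) \<Longrightarrow>
      \<bar>fst h - (x\<^sub>0 + s * u)\<bar> < d * s \<and> norm (rel_moment c\<^sub>0 (x\<^sub>0, T\<^sub>0) h) < \<eta>"
proof -
  define F where "F z = dil (1 / fst z) (snd z + c\<^sub>0 *\<^sub>R (moment_prim u - moment_prim (fst z)) :: 'p fibre)" for z
  have F0: "F (u, 0) = 0"
    by (simp add: F_def linear_0[OF linear_dil])
  have "continuous_on {z. fst z \<noteq> 0} F"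
    unfolding F_def by (intro continuous_intros) auto
  moreover have "open {z :: real \<times> 'p fibre. fst z \<noteq> 0}"
    by (intro open_Collect_neq continuous_intros)
  ultimately have "\<forall>z\<in>{z. fst z \<noteq> 0}. isCont F z"
    using continuous_on_eq_continuous_at by blast
  then have "isCont F (u, 0)" by (rule bspec) (simp add: \<open>u \<noteq> 0\<close>)
  then obtain k where "k > 0" and k: "\<And>z. dist z (u, 0) < k \<Longrightarrow> dist (F z) (F (u, 0)) < \<eta>"
    using \<open>\<eta> > 0\<close> unfolding continuous_at_eps_delta by blast
  have "compact (moment ` {- (\<bar>u\<bar> + 1)..\<bar>u\<bar> + 1} :: 'p fibre set)"
    by (intro compact_continuous_image continuous_intros) auto
  then obtain B where "B > 0" and B: "\<And>y. y \<in> (moment ` {- (\<bar>u\<bar> + 1)..\<bar>u\<bar> + 1} :: 'p fibre set) \<Longrightarrow> norm y \<le> B"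
    using compact_imp_bounded bounded_pos by metis
  \<comment> \<open>In this order the bounds make the moments uniformly bounded, give the claim on the abscissa, and put \<open>(\<mu>, e)\<close> into the \<open>k\<close>-ball around \<open>(u, 0)\<close>.\<close>
  define \<epsilon> where "\<epsilon> = min 1 (min d (min (k / 2) (k / (2 * B))))"
  have \<epsilon>: "\<epsilon> > 0" "\<epsilon> \<le> 1" "\<epsilon> \<le> d" "\<epsilon> \<le> k / 2" "B * \<epsilon> \<le> k / 2"
  proof -
    show "\<epsilon> > 0" using assms \<open>k > 0\<close> \<open>B > 0\<close> by (simp add: \<epsilon>_def)
    have "\<epsilon> \<le> k / (2 * B)" by (simp add: \<epsilon>_def)
    then show "B * \<epsilon> \<le> k / 2" using \<open>B > 0\<close> by (simp add: field_simps)
  qed (simp_all add: \<epsilon>_def)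
  show thesis
  proof (rule that[OF \<open>\<epsilon> > 0\<close>], goal_cases)
    case (1 s h)
    let ?c = "x\<^sub>0 + s * u"
    let ?g = "(?c, T\<^sub>0 + c\<^sub>0 *\<^sub>R (moment_prim ?c - moment_prim x\<^sub>0))"
    from 1(2) obtain a b \<gamma> w where "a < b" and \<gamma>: "horizontal_curve a b \<gamma> w" "\<gamma> a = ?g" "\<gamma> b = h"
      and len: "integral {a<..<b} (\<lambda>\<tau>. norm (w \<tau>)) < \<epsilon> * s"
      by (rule sr_ball_curve)
    define D :: "'p fibre \<Rightarrow> 'p fibre" where "D S = dil (1 / s) (shift (- x\<^sub>0) S)" for S
    have D: "linear D"
      using linear_compose[OF linear_shift linear_dil] unfolding D_def o_def .
    have D_prim: "D (moment_prim y - moment_prim z) = moment_prim ((y - x\<^sub>0) / s) - moment_prim ((z - x\<^sub>0) / s)" for y z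
      unfolding D_def linear_diff[OF linear_shift] linear_diff[OF linear_dil] shift_moment_prim dil_moment_prim
      by (simp add: linear_diff[OF linear_dil] shift_moment_prim dil_moment_prim)
    note estimate = horizontal_curve_estimate[OF \<open>a < b\<close> \<gamma>(1), unfolded \<gamma>(2,3) fst_conv snd_conv]
    have x: "\<bar>fst h - ?c\<bar> < \<epsilon> * s" using estimate(1) len by linarith
    have "norm (D (snd h - (T\<^sub>0 + c\<^sub>0 *\<^sub>R (moment_prim ?c - moment_prim x\<^sub>0)))) \<le> (B / s) * integral {a<..<b} (\<lambda>\<tau>. norm (w \<tau>))"
    proof (rule estimate(2)[OF D])
      fix \<xi> assume "\<bar>\<xi> - ?c\<bar> \<le> integral {a<..<b} (\<lambda>\<tau>. norm (w \<tau>))"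
      then have "\<bar>\<xi> - ?c\<bar> \<le> \<epsilon> * s" using len by linarith
      also have "\<dots> \<le> s" using \<epsilon>(2) \<open>s > 0\<close> by simp
      finally have "\<bar>(\<xi> - x\<^sub>0) / s - u\<bar> \<le> 1"
        using \<open>s > 0\<close> by (simp add: abs_le_iff field_simps)
      then have "norm (moment ((\<xi> - x\<^sub>0) / s) :: 'p fibre) \<le> B"
        by (intro B imageI) auto
      then show "norm (D (moment \<xi>)) \<le> B / s"
        using \<open>s > 0\<close> by (simp add: D_def shift_moment dil_moment divide_right_mono)
    qed
    also have "\<dots> \<le> (B / s) * (\<epsilon> * s)"
      using len \<open>B > 0\<close> \<open>s > 0\<close> by (intro mult_left_mono) auto
    also have "\<dots> \<le> k / 2" using \<epsilon>(5) \<open>s > 0\<close> by simp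
    finally have vertical: "norm (D (snd h - (T\<^sub>0 + c\<^sub>0 *\<^sub>R (moment_prim ?c - moment_prim x\<^sub>0)))) \<le> k / 2" .
    define \<mu> where "\<mu> = (fst h - x\<^sub>0) / s"
    have "\<mu> - u = (fst h - ?c) / s"
      using \<open>s > 0\<close> by (simp add: \<mu>_def diff_divide_distrib add_divide_distrib)
    then have "\<bar>\<mu> - u\<bar> = \<bar>fst h - ?c\<bar> / s"
      by (simp only: abs_divide abs_of_pos[OF \<open>s > 0\<close>])
    then have \<mu>: "\<bar>\<mu> - u\<bar> < \<epsilon>" using x by (simp only: pos_divide_less_eq[OF \<open>s > 0\<close>])
    define e where "e = D (snd h - (T\<^sub>0 + c\<^sub>0 *\<^sub>R (moment_prim ?c - moment_prim x\<^sub>0)))"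
    have scale: "1 / \<mu> * (1 / s) = 1 / (fst h - x\<^sub>0)"
      using \<open>s > 0\<close> by (simp add: \<mu>_def)
    have regroup: "P - Q - c\<^sub>0 *\<^sub>R (m - m\<^sub>0) = (P - (Q + c\<^sub>0 *\<^sub>R (m\<^sub>1 - m\<^sub>0))) + c\<^sub>0 *\<^sub>R (m\<^sub>1 - m)"
      for P Q m m\<^sub>0 m\<^sub>1 :: "'p fibre"
      by (simp add: scaleR_diff_right)
    have centre: "(?c - x\<^sub>0) / s = u" using \<open>s > 0\<close> by simp
    have "rel_moment c\<^sub>0 (x\<^sub>0, T\<^sub>0) h = dil (1 / \<mu>) (D (snd h - T\<^sub>0 - c\<^sub>0 *\<^sub>R (moment_prim (fst h) - moment_prim x\<^sub>0)))"
      unfolding rel_moment_def D_def fst_conv snd_conv dil_dil scale ..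
    also have "snd h - T\<^sub>0 - c\<^sub>0 *\<^sub>R (moment_prim (fst h) - moment_prim x\<^sub>0)
      = (snd h - (T\<^sub>0 + c\<^sub>0 *\<^sub>R (moment_prim ?c - moment_prim x\<^sub>0))) + c\<^sub>0 *\<^sub>R (moment_prim ?c - moment_prim (fst h))"
      by (rule regroup)
    also have "D \<dots> = e + c\<^sub>0 *\<^sub>R (moment_prim u - moment_prim \<mu>)"
      unfolding linear_add[OF D] linear_cmul[OF D] D_prim e_def[symmetric] centre \<mu>_def[symmetric] ..
    finally have "rel_moment c\<^sub>0 (x\<^sub>0, T\<^sub>0) h = F (\<mu>, e)" by (simp add: F_def)
    moreover have "dist (\<mu>, e) (u, 0) < k"
    proof -
      have "dist (\<mu>, e) (u, 0) \<le> \<bar>\<mu> - u\<bar> + norm e"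
        using norm_Pair_le[of "\<mu> - u" e] by (simp add: dist_norm)
      then show ?thesis using \<mu> \<epsilon>(4) vertical unfolding e_def by linarith
    qed
    ultimately have "norm (rel_moment c\<^sub>0 (x\<^sub>0, T\<^sub>0) h) < \<eta>" using k[of "(\<mu>, e)"] F0 by simp
    moreover have "\<bar>fst h - ?c\<bar> < d * s"
      by (rule less_le_trans[OF x mult_right_mono]) (use \<epsilon>(3) \<open>s > 0\<close> in simp_all)
    ultimately show ?case by (rule conjI[rotated])
  qed
qed

section \<open>The inner cone property\<close>

theorem corollary1p3:
  fixes A :: "'p::{finite,linorder} point set"
    and x y u v :: real and t :: "real ^ ('p::{finite,linorder})"
    and Z :: "'p point \<Rightarrow> 'p point"
  assumes "horizontally_convex A"
    and "(x, y, t) \<in> frontier A"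
    and "Z = (\<lambda>g. u *\<^sub>R X_field g + v *\<^sub>R Y_field g)"
    and "(x, y, t) \<odot> lie_exp Z \<in> interior A"
    and "u \<noteq> 0"
  shows "\<exists>\<epsilon>>0. (\<Union>s\<in>{0<..1}. sr_ball ((x, y, t) \<odot> lie_exp (\<lambda>g. s *\<^sub>R Z g)) (\<epsilon> * s)) \<subseteq> interior A"
proof -
  define T where "T = (y, t)"
  define P where "P s = (x + s * u, T + (v / u) *\<^sub>R (moment_prim (x + s * u) - moment_prim x))" for s
  have P: "(x, y, t) \<odot> lie_exp (\<lambda>g. s *\<^sub>R Z g) = P s" for s
    unfolding assms(3) P_def T_def[symmetric] by (rule mult_lie_exp[OF \<open>u \<noteq> 0\<close>])
  have "P 1 \<in> interior A" using assms(4) P[of 1] by simp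
  moreover have "isCont P 1"
    unfolding P_def by (intro continuous_intros isCont_o2[OF _ has_vector_derivative_continuous[OF moment_prim_deriv]])
  ultimately have "\<forall>\<^sub>F s in at 1. P s \<in> interior A"
    using topological_tendstoD[OF _ open_interior] unfolding isCont_def by blast
  then have "\<forall>\<^sub>F s in at_right 1. P s \<in> interior A"
    by (auto intro: filter_leD[OF at_le])
  then obtain b where "b > 1" and b: "\<And>s. 1 < s \<Longrightarrow> s < b \<Longrightarrow> P s \<in> interior A"
    unfolding eventually_at_right_field by blast
  \<comment> \<open>Room beyond the endpoint is needed since balls near \<open>s = 1\<close> contain points of larger abscissa.\<close>
  define \<kappa> where "\<kappa> = (b - 1) / 2"
  have "\<kappa> > 0" "P (1 + \<kappa>) \<in> interior A"
    using \<open>b > 1\<close> b[of "1 + \<kappa>"] by (simp_all add: \<kappa>_def field_simps)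
  define x\<^sub>1 where "x\<^sub>1 = x + (1 + \<kappa>) * u"
  have "(x, T) \<in> closure A" using assms(2) by (simp add: frontier_def T_def)
  moreover have "(x\<^sub>1, T + (v / u) *\<^sub>R (moment_prim x\<^sub>1 - moment_prim x)) \<in> interior A"
    using \<open>P (1 + \<kappa>) \<in> interior A\<close> by (simp add: P_def x\<^sub>1_def)
  ultimately obtain \<eta> where "\<eta> > 0"
    and \<eta>: "{h. fst h \<in> open_segment x x\<^sub>1 \<and> norm (rel_moment (v / u) (x, T) h) < \<eta>} \<subseteq> interior A"
    by (rule cone_region[OF assms(1)])
  \<comment> \<open>Abscissae of the balls then stay strictly between \<open>x\<close> and \<open>x\<^sub>1\<close>: the bound \<open>\<bar>u\<bar> s\<close> serves at \<open>x\<close>, the bound \<open>\<kappa> \<bar>u\<bar>\<close> at \<open>x\<^sub>1\<close>.\<close>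
  define d where "d = min 1 \<kappa> * \<bar>u\<bar>"
  have "d > 0" using \<open>\<kappa> > 0\<close> \<open>u \<noteq> 0\<close> by (simp add: d_def)
  obtain \<epsilon> where "\<epsilon> > 0" and \<epsilon>: "\<And>s h. s > 0 \<Longrightarrow> h \<in> sr_ball (P s) (\<epsilon> * s) \<Longrightarrow>
      \<bar>fst h - (x + s * u)\<bar> < d * s \<and> norm (rel_moment (v / u) (x, T) h) < \<eta>"
    using sr_ball_rel_moment[OF \<open>u \<noteq> 0\<close> \<open>\<eta> > 0\<close> \<open>d > 0\<close>, of x T "v / u"] unfolding P_def by blast
  have "sr_ball (P s) (\<epsilon> * s) \<subseteq> interior A" if s: "s \<in> {0<..1}" for s
  proof
    fix h assume "h \<in> sr_ball (P s) (\<epsilon> * s)"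
    with \<epsilon>[of s h] s have h: "\<bar>fst h - (x + s * u)\<bar> < d * s" "norm (rel_moment (v / u) (x, T) h) < \<eta>"
      by simp_all
    have "d * s \<le> \<bar>u\<bar> * s" using s \<open>u \<noteq> 0\<close> by (intro mult_right_mono) (auto simp: d_def)
    moreover have "d * s \<le> \<kappa> * \<bar>u\<bar>"
      using s \<open>u \<noteq> 0\<close> \<open>\<kappa> > 0\<close> mult_mono[of d "\<kappa> * \<bar>u\<bar>" s 1] by (auto simp: d_def)
    moreover have "s * \<bar>u\<bar> \<le> 1 * \<bar>u\<bar>" using s by (intro mult_right_mono) auto
    moreover have "0 < \<kappa> * \<bar>u\<bar>" using \<open>\<kappa> > 0\<close> \<open>u \<noteq> 0\<close> by simp
    ultimately have bounds: "d * s \<le> s * \<bar>u\<bar>" "d * s \<le> \<kappa> * \<bar>u\<bar>" "s * \<bar>u\<bar> \<le> \<bar>u\<bar>" "0 < \<kappa> * \<bar>u\<bar>"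
      by (simp_all only: mult.commute[of _ s] mult_1)
    have x\<^sub>1: "x\<^sub>1 = x + u + \<kappa> * u" by (simp add: x\<^sub>1_def algebra_simps)
    have "fst h \<in> open_segment x x\<^sub>1"
    proof (cases "u > 0")
      case True
      then have "x < fst h" "fst h < x\<^sub>1"
        using h(1) bounds unfolding x\<^sub>1 abs_less_iff abs_of_pos[OF True] by linarith+
      then show ?thesis by (simp add: open_segment_eq_real_ivl)
    next
      case False
      then have "\<bar>u\<bar> = - u" by simp
      then have "fst h < x" "x\<^sub>1 < fst h"
        using h(1) bounds unfolding x\<^sub>1 abs_less_iff by (simp_all only: mult_minus_right, linarith+)
      then show ?thesis by (simp add: open_segment_eq_real_ivl)
    qed
    with h(2) \<eta> show "h \<in> interior A" by blast
  qed
  then show ?thesis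
    unfolding P using \<open>\<epsilon> > 0\<close> by (intro exI[of _ \<epsilon>]) blast
qed

end
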